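(* Let $f\in C_d^3(\mathbb{R}\setminus\{0\})$. Let $D\in\mathcal{G}(\mathbb{R})$ be an arbitrary $\delta$-modelling generalized function as described in the context, and let $F\in\mathcal{G}(\mathbb{R})$ be the generalized model of $f$ built from $D$, with $F(\varphi_\varepsilon,x)=F_\sigma(x)=(f*D_\sigma)(x)$, $\sigma=\varepsilon s(\varphi)$. Then the product $F\cdot D''$ in $\mathcal{G}(\mathbb{R})$ is associated with a distribution, namely $$F(x)\cdot D''(x)\ \approx\ (h_1+m_2)\,\delta-\Big(\tfrac32h_0+2m_1\Big)\delta'+m_0\,\delta'',$$ where $m_i=\tfrac12\big[f^{(i)}(0_+)+f^{(i)}(0_-)\big]$ and $h_i=f^{(i)}(0_+)-f^{(i)}(0_-)$.
   Context: Test functions: $\mathcal{D}(\mathbb{R})$ is the space of smooth compactly supported functions on $\mathbb{R}$. For $q\in\mathbb{N}_0$, $A_q(\mathbb{R})=\{\varphi\in\mathcal{D}(\mathbb{R}):\int x^j\varphi(x)\,dx=\delta_{0j},\ j=0,\dots,q\}$, with $\delta_{0j}$ the Kronecker symbol. For $\varphi\in A_0(\mathbb{R})$ and $\varepsilon>0$ put $\varphi_\varepsilon(x)=\varepsilon^{-1}\varphi(\varepsilon^{-1}x)$ and $s(\varphi)=\sup\{|x|:\varphi(x)\neq0\}>0$; then $s(\varphi_\varepsilon)=\varepsilon s(\varphi)$, denoted $\sigma$. Colombeau algebra: $\mathcal{E}[\mathbb{R}]$ is the algebra of functions $F(\varphi,x):A_0(\mathbb{R})\times\mathbb{R}\to\mathbb{C}$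 that are smooth in $x$ for each fixed $\varphi$. $\mathcal{G}(\mathbb{R})=\mathcal{E}_M[\mathbb{R}]/\mathcal{I}[\mathbb{R}]$, where $\mathcal{E}_M[\mathbb{R}]$ consists of those $F$ such that for each compact $K\subset\mathbb{R}$ and $p\in\mathbb{N}_0$ there is $q\in\mathbb{N}$ with $\sup_{x\in K}|\partial_x^pF(\varphi_\varepsilon,x)|=O(\varepsilon^{-q})$ as $\varepsilon\to0_+$ for each $\varphi\in A_q(\mathbb{R})$; and $\mathcal{I}[\mathbb{R}]$ consists of those $F$ such that for each compact $K$ and $p\in\mathbb{N}_0$ there is $q\in\mathbb{N}$ with $\sup_{x\in K}|\partial_x^pF(\varphi_\varepsilon,x)|=O(\varepsilon^{r-q})$ as $\varepsilon\to 0_+$ for every $r\ge q$ and $\varphi\in A_r(\mathbb{R})$. Products and derivatives are taken on representatives. Association: $G\in\mathcal{G}(\mathbb{R})$ is associated with a distribution $u$, $G\approx u$, if for some (equivalently any) representative and each $\psi\in\mathcal{D}(\mathbb{R})$ there is $q\in\mathbb{N}_0$ such that for every $\varphi\in A_q(\mathbb{R})$, $\lim_{\varepsilon\to0_+}\int_{\mathbb{R}}G(\varphi_\varepsilon,x)\psi(x)\,dx=\langle u,\psi\rangle$. The $\delta$-modelling function $D$: $D(s,x)$, $s>0$, $x\in\mathbb{R}$, is any function such that for each real $s>0$: $D(s,\cdot)\in\mathcal{D}(\mathbb{R})$, $D(s,-x)=D(s,x)$, and $\frac1s\int_{\mathbb{R}}D^2(s,x)\,dx=\int_{\mathbb{R}}D(s,x)\,dx=1$.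 Put $D_\sigma(x)=\frac1\sigma D\!\left(\sigma,\frac x\sigma\right)$. The generalized function $D\in\mathcal{G}(\mathbb{R})$ is the one with representative $\varphi\mapsto D_{s(\varphi)}$, so its value at $\varphi_\varepsilon$ is $D_\sigma$ with $\sigma=\varepsilon s(\varphi)$; $D''$ is its second derivative in $x$, with value $D_\sigma''(x)=\partial_x^2D_\sigma(x)$ at $\varphi_\varepsilon$. Function class: $C_d^k(\mathbb{R}\setminus\{0\})$ is the class of $k$-times differentiable functions $f$ on $\mathbb{R}\setminus\{0\}$ such that for each $0\le i\le k$ the one-sided limits $f^{(i)}(0_+)$ and $f^{(i)}(0_-)$ exist (finite), possibly different. Such $f$ is regarded as a locally integrable function on $\mathbb{R}$, $*$ denotes convolution, and the generalized model $F$ of $f$ has the representative $\varphi\mapsto f*D_{s(\varphi)}$. $\delta$ is the Dirac distribution at $0$ and $\delta',\delta''$ its derivatives.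
   Formalization: Added assumption: as s→0+, the supports of D(s,·) lie in one bounded interval and ∫|D(s,x)|²dx stays bounded. Without it the claim fails: D(s,x)=s·g(sx), g even, ∫g=∫g²=1, gives D_σ=g for all σ, so f=1 is a counterexample. D is complex-valued. *)

theory Defs
  imports "HOL-Analysis.Analysis" "HOL-Library.Landau_Symbols"
begin

section \<open>Smooth functions and test functions\<close>

definition vderiv :: "(real \<Rightarrow> complex) \<Rightarrow> real \<Rightarrow> complex" where
  "vderiv g = (\<lambda>x. vector_derivative g (at x))"

definition smooth :: "(real \<Rightarrow> complex) \<Rightarrow> bool" where
  "smooth g \<longleftrightarrow> (\<forall>k x. (vderiv ^^ k) g differentiable at x)"

definition test_funs :: "(real \<Rightarrow> complex) set" where
  "test_funs = {\<phi>. smooth \<phi> \<and> compact (closure {x. \<phi> x \<noteq> 0})}"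

definition A_test :: "nat \<Rightarrow> (real \<Rightarrow> complex) set" where
  "A_test q = {\<phi> \<in> test_funs.
     \<forall>j\<le>q. (LINT x|lborel. of_real (x ^ j) * \<phi> x) = (if j = 0 then 1 else 0)}"

definition scaled :: "real \<Rightarrow> (real \<Rightarrow> complex) \<Rightarrow> real \<Rightarrow> complex" where
  "scaled \<epsilon> \<phi> = (\<lambda>x. \<phi> (x / \<epsilon>) / of_real \<epsilon>)"

definition supp_radius :: "(real \<Rightarrow> complex) \<Rightarrow> real" where
  "supp_radius \<phi> = (SUP x\<in>{x. \<phi> x \<noteq> 0}. \<bar>x\<bar>)"


section \<open>The Colombeau algebra\<close>

text \<open>
  Elements of the basic algebra are total functions of \<open>\<phi>\<close>; their values at \<open>\<phi>\<close> outside
  \<open>A_test 0\<close> are irrelevant, being ignored by the equivalence relation below.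
\<close>

type_synonym representative = "(real \<Rightarrow> complex) \<Rightarrow> real \<Rightarrow> complex"

definition E_basic :: "representative set" where
  "E_basic = {F. \<forall>\<phi>\<in>A_test 0. smooth (F \<phi>)}"

definition sup_deriv :: "representative \<Rightarrow> real set \<Rightarrow> nat \<Rightarrow> (real \<Rightarrow> complex) \<Rightarrow> real \<Rightarrow> real" where
  "sup_deriv F K p \<phi> = (\<lambda>\<epsilon>. SUP x\<in>K. norm ((vderiv ^^ p) (F (scaled \<epsilon> \<phi>)) x))"

definition E_M :: "representative set" where
  "E_M = {F \<in> E_basic. \<forall>K p. compact K \<and> K \<noteq> {} \<longrightarrow>
     (\<exists>q. \<forall>\<phi>\<in>A_test q. sup_deriv F K p \<phi> \<in> O[at_right 0](\<lambda>\<epsilon>. 1 / \<epsilon> ^ q))}"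

definition E_null :: "representative set" where
  "E_null = {F \<in> E_basic. \<forall>K p. compact K \<and> K \<noteq> {} \<longrightarrow>
     (\<exists>q. \<forall>r\<ge>q. \<forall>\<phi>\<in>A_test r. sup_deriv F K p \<phi> \<in> O[at_right 0](\<lambda>\<epsilon>. \<epsilon> ^ (r - q)))}"

definition colombeau_eq :: "representative \<Rightarrow> representative \<Rightarrow> bool" where
  "colombeau_eq F G \<longleftrightarrow> F \<in> E_M \<and> G \<in> E_M \<and> (\<lambda>\<phi> x. F \<phi> x - G \<phi> x) \<in> E_null"


subsection \<open>Well-definedness of the quotient and its operations\<close>

definition smooth_upto :: "nat \<Rightarrow> (real \<Rightarrow> complex) \<Rightarrow> bool" where
  "smooth_upto n g \<longleftrightarrow> (\<forall>k\<le>n. \<forall>x. (vderiv ^^ k) g differentiable at x)"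

lemma smooth_iff_upto: "smooth g \<longleftrightarrow> (\<forall>n. smooth_upto n g)"
  by (auto simp: smooth_def smooth_upto_def)

lemma smooth_upto_0: "smooth_upto 0 g \<longleftrightarrow> (\<forall>x. g differentiable at x)"
  by (simp add: smooth_upto_def)

lemma vderiv_funpow_Suc: "(vderiv ^^ Suc k) g = (vderiv ^^ k) (vderiv g)"
  by (simp add: funpow_swap1)

lemma smooth_upto_Suc:
  "smooth_upto (Suc n) g \<longleftrightarrow> (\<forall>x. g differentiable at x) \<and> smooth_upto n (vderiv g)"
proof -
  have "smooth_upto (Suc n) g \<longleftrightarrow>
     (\<forall>x. g differentiable at x) \<and> (\<forall>k\<le>n. \<forall>x. (vderiv ^^ Suc k) g differentiable at x)"
    unfolding smooth_upto_def
    by (metis funpow_0 less_eq_nat.simps(1) not0_implies_Suc Suc_le_mono)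
  then show ?thesis
    by (simp only: vderiv_funpow_Suc smooth_upto_def)
qed

lemma smooth_upto_mono: "smooth_upto (Suc n) g \<Longrightarrow> smooth_upto n g"
  by (simp add: smooth_upto_def)

lemma smooth_differentiable: "smooth g \<Longrightarrow> g differentiable at x"
  unfolding smooth_def by (metis funpow_0)

lemma smooth_vderiv: "smooth g \<Longrightarrow> smooth (vderiv g)"
  by (simp add: smooth_iff_upto) (metis smooth_upto_Suc)

lemma smooth_vderiv_funpow: "smooth g \<Longrightarrow> smooth ((vderiv ^^ k) g)"
  by (induction k) (auto intro: smooth_vderiv)

lemma vderiv_add:
  assumes "\<And>x. f differentiable at x" "\<And>x. g differentiable at x"
  shows "vderiv (\<lambda>x. f x + g x) = (\<lambda>x. vderiv f x + vderiv g x)"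
  using assms by (simp add: vderiv_def)

lemma vderiv_diff:
  assumes "\<And>x. f differentiable at x" "\<And>x. g differentiable at x"
  shows "vderiv (\<lambda>x. f x - g x) = (\<lambda>x. vderiv f x - vderiv g x)"
  using assms by (simp add: vderiv_def)

lemma vderiv_mult:
  assumes "\<And>x. f differentiable at x" "\<And>x. g differentiable at x"
  shows "vderiv (\<lambda>x. f x * g x) = (\<lambda>x. f x * vderiv g x + vderiv f x * g x)"
  using assms by (simp add: vderiv_def)

lemma smooth_upto_add:
  "smooth_upto n f \<Longrightarrow> smooth_upto n g \<Longrightarrow> smooth_upto n (\<lambda>x. f x + g x)"
proof (induction n arbitrary: f g)
  case (Suc n)
  then show ?case
    by (auto simp: smooth_upto_Suc vderiv_add intro: differentiable_add)
qed (auto simp: smooth_upto_0)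

lemma smooth_upto_diff:
  "smooth_upto n f \<Longrightarrow> smooth_upto n g \<Longrightarrow> smooth_upto n (\<lambda>x. f x - g x)"
proof (induction n arbitrary: f g)
  case (Suc n)
  then show ?case
    by (auto simp: smooth_upto_Suc vderiv_diff intro: differentiable_diff)
qed (auto simp: smooth_upto_0)

lemma smooth_upto_mult:
  "smooth_upto n f \<Longrightarrow> smooth_upto n g \<Longrightarrow> smooth_upto n (\<lambda>x. f x * g x)"
proof (induction n arbitrary: f g)
  case (Suc n)
  have "smooth_upto n f" "smooth_upto n g"
    using Suc.prems by (auto intro: smooth_upto_mono)
  with Suc show ?case
    by (auto simp: smooth_upto_Suc vderiv_mult intro!: differentiable_mult smooth_upto_add)
qed (auto simp: smooth_upto_0)

lemma smooth_add: "smooth f \<Longrightarrow> smooth g \<Longrightarrow> smooth (\<lambda>x. f x + g x)"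
  by (simp add: smooth_iff_upto smooth_upto_add)

lemma smooth_diff: "smooth f \<Longrightarrow> smooth g \<Longrightarrow> smooth (\<lambda>x. f x - g x)"
  by (simp add: smooth_iff_upto smooth_upto_diff)

lemma smooth_mult: "smooth f \<Longrightarrow> smooth g \<Longrightarrow> smooth (\<lambda>x. f x * g x)"
  by (simp add: smooth_iff_upto smooth_upto_mult)

lemma vderiv_funpow_zero: "(vderiv ^^ k) (\<lambda>x. 0) = (\<lambda>x. 0)"
  by (induction k) (auto simp: vderiv_def)

lemma smooth_zero: "smooth (\<lambda>x. 0)"
  by (simp add: smooth_def vderiv_funpow_zero)

lemma vderiv_funpow_add:
  assumes "smooth f" "smooth g"
  shows "(vderiv ^^ k) (\<lambda>x. f x + g x) = (\<lambda>x. (vderiv ^^ k) f x + (vderiv ^^ k) g x)"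
  by (induction k)
     (use assms in \<open>auto simp: vderiv_add smooth_differentiable smooth_vderiv_funpow\<close>)

lemma vderiv_funpow_diff:
  assumes "smooth f" "smooth g"
  shows "(vderiv ^^ k) (\<lambda>x. f x - g x) = (\<lambda>x. (vderiv ^^ k) f x - (vderiv ^^ k) g x)"
  by (induction k)
     (use assms in \<open>auto simp: vderiv_diff smooth_differentiable smooth_vderiv_funpow\<close>)

lemma vderiv_scaled:
  assumes "\<And>x. g differentiable at x" "a \<noteq> 0"
  shows "vderiv (\<lambda>x. c * g (x / a)) = (\<lambda>x. (c / of_real a) * vderiv g (x / a))"
proof
  fix x
  have "(g has_vector_derivative vderiv g (x / a)) (at (x / a))"
    using assms(1) by (simp add: vderiv_def vector_derivative_works)
  moreover have "((\<lambda>x. x / a) has_vector_derivative (1 / a)) (at x)"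
    using assms(2) by (auto intro!: derivative_eq_intros simp: has_real_derivative_iff_has_vector_derivative [symmetric])
  ultimately have "(g \<circ> (\<lambda>x. x / a) has_vector_derivative (1 / a) *\<^sub>R vderiv g (x / a)) (at x)"
    by (metis vector_diff_chain_at)
  then have "((\<lambda>x. c * g (x / a)) has_vector_derivative c * ((1 / a) *\<^sub>R vderiv g (x / a))) (at x)"
    by (intro has_vector_derivative_mult_right) (simp add: o_def)
  then show "vderiv (\<lambda>x. c * g (x / a)) x = (c / of_real a) * vderiv g (x / a)"
    by (simp add: vderiv_def vector_derivative_at scaleR_conv_of_real)
qed

lemma smooth_affine:
  assumes "smooth g" "a \<noteq> 0"
  shows "smooth (\<lambda>x. c * g (x / a))"
proof -
  have "\<forall>x. (\<lambda>x. c * g (x / a)) differentiable at x" if "smooth g" for g c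
  proof
    fix x
    have "g \<circ> (\<lambda>x. x / a) differentiable at x"
      using that assms(2) by (intro differentiable_chain_at) (auto simp: smooth_differentiable)
    then show "(\<lambda>x. c * g (x / a)) differentiable at x"
      by (auto simp: o_def intro!: differentiable_mult)
  qed
  note diff = this
  have "smooth_upto n (\<lambda>x. c * g (x / a))" if "smooth g" for n c g
    using that
  proof (induction n arbitrary: c g)
    case 0
    then show ?case unfolding smooth_upto_0 using diff by blast
  next
    case (Suc n)
    have "smooth_upto n (\<lambda>x. (c / of_real a) * vderiv g (x / a))"
      using Suc by (intro Suc.IH smooth_vderiv)
    then have "smooth_upto n (vderiv (\<lambda>x. c * g (x / a)))"
      using Suc.prems assms(2) by (subst vderiv_scaled) (auto simp: smooth_differentiable)
    then show ?case unfolding smooth_upto_Suc using diff Suc.prems by blast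
  qed
  with assms show ?thesis by (simp add: smooth_iff_upto)
qed

lemma A_antimono: "q \<le> r \<Longrightarrow> A_test r \<subseteq> A_test q"
  by (auto simp: A_test_def)

lemma scaled_in_A:
  assumes "\<phi> \<in> A_test q" "\<epsilon> > 0"
  shows "scaled \<epsilon> \<phi> \<in> A_test q"
proof -
  have sm: "smooth (\<lambda>x. (1 / of_real \<epsilon>) * \<phi> (x / \<epsilon>))"
    using assms by (intro smooth_affine) (auto simp: A_test_def test_funs_def)
  have "bounded {x. \<phi> x \<noteq> 0}"
    using assms by (simp add: A_test_def test_funs_def)
  then have "bounded ((*) \<epsilon> ` {x. \<phi> x \<noteq> 0})"
    using bounded_scaling[of "{x. \<phi> x \<noteq> 0}" \<epsilon>] by simp
  moreover have "{x. scaled \<epsilon> \<phi> x \<noteq> 0} \<subseteq> (*) \<epsilon> ` {x. \<phi> x \<noteq> 0}"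
  proof
    fix x assume "x \<in> {x. scaled \<epsilon> \<phi> x \<noteq> 0}"
    then have "x = \<epsilon> * (x / \<epsilon>)" "\<phi> (x / \<epsilon>) \<noteq> 0" using assms by (auto simp: scaled_def)
    then show "x \<in> (*) \<epsilon> ` {x. \<phi> x \<noteq> 0}" by blast
  qed
  ultimately have bd: "bounded {x. scaled \<epsilon> \<phi> x \<noteq> 0}"
    by (rule bounded_subset)
  have "(LINT x|lborel. of_real (x ^ j) * scaled \<epsilon> \<phi> x) =
        of_real (\<epsilon> ^ j) * (LINT x|lborel. of_real (x ^ j) * \<phi> x)" for j
  proof -
    have "(LINT x|lborel. of_real (x ^ j) * scaled \<epsilon> \<phi> x) =
        \<bar>\<epsilon>\<bar> *\<^sub>R (LINT x|lborel. of_real ((0 + \<epsilon> * x) ^ j) * scaled \<epsilon> \<phi> (0 + \<epsilon> * x))"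
      using assms by (intro lborel_integral_real_affine) auto
    also have "\<dots> = (LINT x|lborel. of_real (\<epsilon> ^ j) * (of_real (x ^ j) * \<phi> x))"
      using assms
      unfolding integral_scaleR_right [symmetric]
      by (intro Bochner_Integration.integral_cong refl)
         (simp add: scaled_def power_mult_distrib scaleR_conv_of_real)
    also have "\<dots> = of_real (\<epsilon> ^ j) * (LINT x|lborel. of_real (x ^ j) * \<phi> x)"
      by (rule integral_mult_right_zero)
    finally show ?thesis .
  qed
  with assms sm bd show ?thesis
    by (auto simp: A_test_def test_funs_def scaled_def)
qed

lemma sup_deriv_bigo_iff:
  assumes "F \<in> E_basic" "\<phi> \<in> A_test 0" "compact K" "K \<noteq> {}"
  shows "sup_deriv F K p \<phi> \<in> O[at_right 0](h) \<longleftrightarrow>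
    (\<exists>C. \<forall>\<^sub>F \<epsilon> in at_right 0. \<forall>x\<in>K.
       norm ((vderiv ^^ p) (F (scaled \<epsilon> \<phi>)) x) \<le> C * norm (h \<epsilon>))" (is "_ \<longleftrightarrow> ?R")
proof -
  have bdd: "bdd_above ((\<lambda>x. norm ((vderiv ^^ p) (F (scaled \<epsilon> \<phi>)) x)) ` K)" if "\<epsilon> > 0" for \<epsilon>
  proof -
    have "smooth (F (scaled \<epsilon> \<phi>))"
      using assms that scaled_in_A by (auto simp: E_basic_def)
    then have "continuous_on K ((vderiv ^^ p) (F (scaled \<epsilon> \<phi>)))"
      by (meson smooth_vderiv_funpow smooth_differentiable continuous_at_imp_continuous_on
            differentiable_imp_continuous_within)
    then have "compact ((\<lambda>x. norm ((vderiv ^^ p) (F (scaled \<epsilon> \<phi>)) x)) ` K)"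
      using assms by (intro compact_continuous_image continuous_on_norm)
    then show ?thesis by (simp add: bounded_imp_bdd_above compact_imp_bounded)
  qed
  obtain k where k: "k \<in> K" using assms by blast
  have eq: "norm (sup_deriv F K p \<phi> \<epsilon>) \<le> c \<longleftrightarrow>
      (\<forall>x\<in>K. norm ((vderiv ^^ p) (F (scaled \<epsilon> \<phi>)) x) \<le> c)" if "\<epsilon> > 0" for \<epsilon> c
  proof -
    have "0 \<le> sup_deriv F K p \<phi> \<epsilon>"
      unfolding sup_deriv_def
      using cSUP_upper[OF k bdd[OF that]] norm_ge_zero order_trans by blast
    then show ?thesis
      using cSUP_le_iff[OF assms(4) bdd[OF that]] by (simp add: sup_deriv_def)
  qed
  have pos: "\<forall>\<^sub>F \<epsilon> in at_right (0::real). \<epsilon> > 0"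
    by (simp add: eventually_at_right_less)
  have "sup_deriv F K p \<phi> \<in> O[at_right 0](h) \<longleftrightarrow>
     (\<exists>C. \<forall>\<^sub>F \<epsilon> in at_right 0. norm (sup_deriv F K p \<phi> \<epsilon>) \<le> C * norm (h \<epsilon>))"
    by (blast intro: bigoI elim: landau_o.bigE)
  also have "\<dots> \<longleftrightarrow> ?R"
    by (intro ex_cong1 eventually_cong[OF pos] eq)
  finally show ?thesis .
qed

definition dx :: "representative \<Rightarrow> representative" where
  "dx F = (\<lambda>\<phi>. vderiv (F \<phi>))"

lemma sup_deriv_Suc: "sup_deriv F K (Suc p) = sup_deriv (dx F) K p"
  by (intro ext) (simp only: sup_deriv_def dx_def vderiv_funpow_Suc)

lemma E_basic_dx: "F \<in> E_basic \<Longrightarrow> dx F \<in> E_basic"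
  by (simp add: E_basic_def dx_def smooth_vderiv)

lemma E_basic_mult: "F \<in> E_basic \<Longrightarrow> G \<in> E_basic \<Longrightarrow> (\<lambda>\<phi> x. F \<phi> x * G \<phi> x) \<in> E_basic"
  by (simp add: E_basic_def smooth_mult)

lemma E_basic_add: "F \<in> E_basic \<Longrightarrow> G \<in> E_basic \<Longrightarrow> (\<lambda>\<phi> x. F \<phi> x + G \<phi> x) \<in> E_basic"
  by (simp add: E_basic_def smooth_add)

lemma E_basic_diff: "F \<in> E_basic \<Longrightarrow> G \<in> E_basic \<Longrightarrow> (\<lambda>\<phi> x. F \<phi> x - G \<phi> x) \<in> E_basic"
  by (simp add: E_basic_def smooth_diff)

lemma sup_deriv_add_bigo:
  assumes "F \<in> E_basic" "G \<in> E_basic" "\<phi> \<in> A_test 0" "compact K" "K \<noteq> {}"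
    and "sup_deriv F K p \<phi> \<in> O[at_right 0](h)" "sup_deriv G K p \<phi> \<in> O[at_right 0](h)"
  shows "sup_deriv (\<lambda>\<phi> x. F \<phi> x + G \<phi> x) K p \<phi> \<in> O[at_right 0](h)"
proof -
  obtain C D where CD:
    "\<forall>\<^sub>F \<epsilon> in at_right 0. \<forall>x\<in>K. norm ((vderiv ^^ p) (F (scaled \<epsilon> \<phi>)) x) \<le> C * norm (h \<epsilon>)"
    "\<forall>\<^sub>F \<epsilon> in at_right 0. \<forall>x\<in>K. norm ((vderiv ^^ p) (G (scaled \<epsilon> \<phi>)) x) \<le> D * norm (h \<epsilon>)"
    using assms by (auto simp: sup_deriv_bigo_iff)
  have "\<forall>\<^sub>F \<epsilon> in at_right 0. \<forall>x\<in>K.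
     norm ((vderiv ^^ p) (\<lambda>x. F (scaled \<epsilon> \<phi>) x + G (scaled \<epsilon> \<phi>) x) x) \<le> (C + D) * norm (h \<epsilon>)"
    using CD eventually_at_right_less[of 0]
  proof eventually_elim
    case (elim \<epsilon>)
    have "smooth (F (scaled \<epsilon> \<phi>))" "smooth (G (scaled \<epsilon> \<phi>))"
      using assms elim scaled_in_A by (auto simp: E_basic_def)
    then show ?case using elim
      by (auto simp: vderiv_funpow_add algebra_simps intro!: norm_triangle_mono)
  qed
  with assms show ?thesis
    by (subst sup_deriv_bigo_iff) (auto intro: E_basic_add)
qed

lemma sup_deriv_diff_bigo:
  assumes "F \<in> E_basic" "G \<in> E_basic" "\<phi> \<in> A_test 0" "compact K" "K \<noteq> {}"
    and "sup_deriv F K p \<phi> \<in> O[at_right 0](h)" "sup_deriv G K p \<phi> \<in> O[at_right 0](h)"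
  shows "sup_deriv (\<lambda>\<phi> x. F \<phi> x - G \<phi> x) K p \<phi> \<in> O[at_right 0](h)"
proof -
  obtain C D where CD:
    "\<forall>\<^sub>F \<epsilon> in at_right 0. \<forall>x\<in>K. norm ((vderiv ^^ p) (F (scaled \<epsilon> \<phi>)) x) \<le> C * norm (h \<epsilon>)"
    "\<forall>\<^sub>F \<epsilon> in at_right 0. \<forall>x\<in>K. norm ((vderiv ^^ p) (G (scaled \<epsilon> \<phi>)) x) \<le> D * norm (h \<epsilon>)"
    using assms by (auto simp: sup_deriv_bigo_iff)
  have "\<forall>\<^sub>F \<epsilon> in at_right 0. \<forall>x\<in>K.
     norm ((vderiv ^^ p) (\<lambda>x. F (scaled \<epsilon> \<phi>) x - G (scaled \<epsilon> \<phi>) x) x) \<le> (C + D) * norm (h \<epsilon>)"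
    using CD eventually_at_right_less[of 0]
  proof eventually_elim
    case (elim \<epsilon>)
    have "smooth (F (scaled \<epsilon> \<phi>))" "smooth (G (scaled \<epsilon> \<phi>))"
      using assms elim scaled_in_A by (auto simp: E_basic_def)
    then show ?case using elim
      by (auto simp: vderiv_funpow_diff algebra_simps intro!: order_trans[OF norm_triangle_ineq4] add_mono)
  qed
  with assms show ?thesis
    by (subst sup_deriv_bigo_iff) (auto intro: E_basic_diff)
qed

lemma sup_deriv_mult_bigo:
  assumes "F \<in> E_basic" "G \<in> E_basic" "\<phi> \<in> A_test 0" "compact K" "K \<noteq> {}"
    and "\<And>i. i \<le> p \<Longrightarrow> sup_deriv F K i \<phi> \<in> O[at_right 0](h)"
    and "\<And>i. i \<le> p \<Longrightarrow> sup_deriv G K i \<phi> \<in> O[at_right 0](k)"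
  shows "sup_deriv (\<lambda>\<phi> x. F \<phi> x * G \<phi> x) K p \<phi> \<in> O[at_right 0](\<lambda>\<epsilon>. h \<epsilon> * k \<epsilon>)"
  using assms
proof (induction p arbitrary: F G)
  case 0
  obtain C D where CD:
    "\<forall>\<^sub>F \<epsilon> in at_right 0. \<forall>x\<in>K. norm (F (scaled \<epsilon> \<phi>) x) \<le> C * norm (h \<epsilon>)"
    "\<forall>\<^sub>F \<epsilon> in at_right 0. \<forall>x\<in>K. norm (G (scaled \<epsilon> \<phi>) x) \<le> D * norm (k \<epsilon>)"
    using 0 sup_deriv_bigo_iff[where p = 0] by auto
  have "\<forall>\<^sub>F \<epsilon> in at_right 0. \<forall>x\<in>K.
     norm (F (scaled \<epsilon> \<phi>) x * G (scaled \<epsilon> \<phi>) x) \<le> (C * D) * norm (h \<epsilon> * k \<epsilon>)"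
    using CD
  proof eventually_elim
    case (elim \<epsilon>)
    show ?case
    proof
      fix x assume "x \<in> K"
      then have "norm (F (scaled \<epsilon> \<phi>) x) * norm (G (scaled \<epsilon> \<phi>) x) \<le>
          (C * norm (h \<epsilon>)) * (D * norm (k \<epsilon>))"
        using elim by (intro mult_mono) (auto intro: order_trans[OF norm_ge_zero])
      then show "norm (F (scaled \<epsilon> \<phi>) x * G (scaled \<epsilon> \<phi>) x) \<le> (C * D) * norm (h \<epsilon> * k \<epsilon>)"
        by (simp add: norm_mult abs_mult mult_ac)
    qed
  qed
  with 0 show ?case
    by (subst sup_deriv_bigo_iff) (auto intro: E_basic_mult)
next
  case (Suc p)
  have sm: "smooth (F (scaled \<epsilon> \<phi>))" "smooth (G (scaled \<epsilon> \<phi>))" if "\<epsilon> > 0" for \<epsilon>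
    using Suc.prems that scaled_in_A by (auto simp: E_basic_def)
  have "sup_deriv (\<lambda>\<phi> x. F \<phi> x * dx G \<phi> x + dx F \<phi> x * G \<phi> x) K p \<phi>
      \<in> O[at_right 0](\<lambda>\<epsilon>. h \<epsilon> * k \<epsilon>)"
  proof (intro sup_deriv_add_bigo)
    show "sup_deriv (\<lambda>\<phi> x. F \<phi> x * dx G \<phi> x) K p \<phi> \<in> O[at_right 0](\<lambda>\<epsilon>. h \<epsilon> * k \<epsilon>)"
      using Suc.prems
      by (intro Suc.IH) (auto intro: E_basic_dx simp flip: sup_deriv_Suc)
    show "sup_deriv (\<lambda>\<phi> x. dx F \<phi> x * G \<phi> x) K p \<phi> \<in> O[at_right 0](\<lambda>\<epsilon>. h \<epsilon> * k \<epsilon>)"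
      using Suc.prems
      by (intro Suc.IH) (auto intro: E_basic_dx simp flip: sup_deriv_Suc)
  qed (use Suc.prems in \<open>auto intro: E_basic_dx E_basic_mult\<close>)
  moreover have "\<forall>\<^sub>F \<epsilon> in at_right 0.
      sup_deriv (\<lambda>\<phi> x. F \<phi> x * dx G \<phi> x + dx F \<phi> x * G \<phi> x) K p \<phi> \<epsilon> =
      sup_deriv (\<lambda>\<phi> x. F \<phi> x * G \<phi> x) K (Suc p) \<phi> \<epsilon>"
    using eventually_at_right_less[of 0]
  proof eventually_elim
    case (elim \<epsilon>)
    then show ?case
      unfolding sup_deriv_def vderiv_funpow_Suc
      by (subst vderiv_mult) (auto simp: dx_def sm smooth_differentiable)
  qed
  ultimately show ?case
    by (rule landau_o.big.in_cong[THEN iffD1, rotated])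
qed

lemma inverse_power_bigo:
  assumes "m \<le> n"
  shows "(\<lambda>\<epsilon>::real. 1 / \<epsilon> ^ m) \<in> O[at_right 0](\<lambda>\<epsilon>. 1 / \<epsilon> ^ n)"
proof (rule bigoI[where c = 1])
  have "\<forall>\<^sub>F \<epsilon> in at_right (0::real). \<epsilon> \<in> {0<..<1}"
    by (intro eventually_at_right_real) auto
  then show "\<forall>\<^sub>F \<epsilon>::real in at_right 0. norm (1 / \<epsilon> ^ m) \<le> 1 * norm (1 / \<epsilon> ^ n)"
  proof eventually_elim
    case (elim \<epsilon>)
    then have "\<epsilon> ^ n \<le> \<epsilon> ^ m" using assms by (intro power_decreasing) auto
    then show ?case using elim by (simp add: frac_le)
  qed
qed

lemma power_bigo:
  assumes "m \<le> n"
  shows "(\<lambda>\<epsilon>::real. \<epsilon> ^ n) \<in> O[at_right 0](\<lambda>\<epsilon>. \<epsilon> ^ m)"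
proof (rule bigoI[where c = 1])
  have "\<forall>\<^sub>F \<epsilon> in at_right (0::real). \<epsilon> \<in> {0<..<1}"
    by (intro eventually_at_right_real) auto
  then show "\<forall>\<^sub>F \<epsilon>::real in at_right 0. norm (\<epsilon> ^ n) \<le> 1 * norm (\<epsilon> ^ m)"
    by eventually_elim (use assms in \<open>auto intro: power_decreasing\<close>)
qed

lemma E_M_uniform:
  assumes "F \<in> E_M" "compact K" "K \<noteq> {}"
  obtains q where
    "\<And>i \<phi>. i \<le> p \<Longrightarrow> \<phi> \<in> A_test q \<Longrightarrow> sup_deriv F K i \<phi> \<in> O[at_right 0](\<lambda>\<epsilon>. 1 / \<epsilon> ^ q)"
proof -
  obtain q where q: "\<And>i \<phi>. \<phi> \<in> A_test (q i) \<Longrightarrow> sup_deriv F K i \<phi> \<in> O[at_right 0](\<lambda>\<epsilon>. 1 / \<epsilon> ^ q i)"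
    using assms unfolding E_M_def mem_Collect_eq by metis
  define Q where "Q = Max (q ` {..p})"
  have le: "q i \<le> Q" if "i \<le> p" for i using that by (auto simp: Q_def)
  show ?thesis
  proof (rule that[of Q])
    fix i \<phi> assume "i \<le> p" "\<phi> \<in> A_test Q"
    then have "\<phi> \<in> A_test (q i)" using le A_antimono by blast
    then show "sup_deriv F K i \<phi> \<in> O[at_right 0](\<lambda>\<epsilon>. 1 / \<epsilon> ^ Q)"
      using q inverse_power_bigo[OF le[OF \<open>i \<le> p\<close>]] landau_o.big_trans by blast
  qed
qed

lemma E_null_uniform:
  assumes "F \<in> E_null" "compact K" "K \<noteq> {}"
  obtains q where
    "\<And>i r \<phi>. i \<le> p \<Longrightarrow> q \<le> r \<Longrightarrow> \<phi> \<in> A_test r \<Longrightarrow>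
       sup_deriv F K i \<phi> \<in> O[at_right 0](\<lambda>\<epsilon>. \<epsilon> ^ (r - q))"
proof -
  obtain q where q: "\<And>i r \<phi>. q i \<le> r \<Longrightarrow> \<phi> \<in> A_test r \<Longrightarrow>
      sup_deriv F K i \<phi> \<in> O[at_right 0](\<lambda>\<epsilon>. \<epsilon> ^ (r - q i))"
    using assms unfolding E_null_def mem_Collect_eq by metis
  define Q where "Q = Max (q ` {..p})"
  have le: "q i \<le> Q" if "i \<le> p" for i using that by (auto simp: Q_def)
  show ?thesis
  proof (rule that[of Q])
    fix i r \<phi> assume "i \<le> p" "Q \<le> r" "\<phi> \<in> A_test r"
    then have "sup_deriv F K i \<phi> \<in> O[at_right 0](\<lambda>\<epsilon>. \<epsilon> ^ (r - q i))"
      using q le order_trans by blast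
    moreover have "(\<lambda>\<epsilon>. \<epsilon> ^ (r - q i)) \<in> O[at_right 0](\<lambda>\<epsilon>::real. \<epsilon> ^ (r - Q))"
      using le[OF \<open>i \<le> p\<close>] by (intro power_bigo diff_le_mono2)
    ultimately show "sup_deriv F K i \<phi> \<in> O[at_right 0](\<lambda>\<epsilon>. \<epsilon> ^ (r - Q))"
      by (rule landau_o.big_trans)
  qed
qed

lemma E_M_basic: "F \<in> E_M \<Longrightarrow> F \<in> E_basic"
  by (simp add: E_M_def)

lemma E_null_basic: "F \<in> E_null \<Longrightarrow> F \<in> E_basic"
  by (simp add: E_null_def)

lemma E_M_dx: "F \<in> E_M \<Longrightarrow> dx F \<in> E_M"
  unfolding E_M_def mem_Collect_eq by (auto simp: E_basic_dx simp flip: sup_deriv_Suc)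

lemma E_null_dx: "F \<in> E_null \<Longrightarrow> dx F \<in> E_null"
  unfolding E_null_def mem_Collect_eq by (auto simp: E_basic_dx simp flip: sup_deriv_Suc)

lemma E_M_mult:
  assumes "F \<in> E_M" "G \<in> E_M"
  shows "(\<lambda>\<phi> x. F \<phi> x * G \<phi> x) \<in> E_M"
  unfolding E_M_def mem_Collect_eq
proof (intro conjI allI impI; (elim conjE)?)
  show "(\<lambda>\<phi> x. F \<phi> x * G \<phi> x) \<in> E_basic"
    using assms by (intro E_basic_mult E_M_basic)
  fix K :: "real set" and p assume K: "compact K" "K \<noteq> {}"
  obtain a where a:
    "\<And>i \<phi>. i \<le> p \<Longrightarrow> \<phi> \<in> A_test a \<Longrightarrow> sup_deriv F K i \<phi> \<in> O[at_right 0](\<lambda>\<epsilon>. 1 / \<epsilon> ^ a)"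
    using E_M_uniform[OF assms(1) K] by blast
  obtain b where b:
    "\<And>i \<phi>. i \<le> p \<Longrightarrow> \<phi> \<in> A_test b \<Longrightarrow> sup_deriv G K i \<phi> \<in> O[at_right 0](\<lambda>\<epsilon>. 1 / \<epsilon> ^ b)"
    using E_M_uniform[OF assms(2) K] by blast
  have "sup_deriv (\<lambda>\<phi> x. F \<phi> x * G \<phi> x) K p \<phi> \<in> O[at_right 0](\<lambda>\<epsilon>. 1 / \<epsilon> ^ (a + b))"
    if "\<phi> \<in> A_test (a + b)" for \<phi>
  proof -
    have in_A: "\<phi> \<in> A_test 0" "\<phi> \<in> A_test a" "\<phi> \<in> A_test b"
      using that A_antimono[THEN subsetD, of _ "a + b" \<phi>] by auto
    have "sup_deriv (\<lambda>\<phi> x. F \<phi> x * G \<phi> x) K p \<phi> \<in> O[at_right 0](\<lambda>\<epsilon>. (1 / \<epsilon> ^ a) * (1 / \<epsilon> ^ b))"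
      using assms K in_A a b by (intro sup_deriv_mult_bigo) (auto intro: E_M_basic)
    then show ?thesis by (simp add: power_add)
  qed
  then show "\<exists>q. \<forall>\<phi>\<in>A_test q. sup_deriv (\<lambda>\<phi> x. F \<phi> x * G \<phi> x) K p \<phi> \<in> O[at_right 0](\<lambda>\<epsilon>. 1 / \<epsilon> ^ q)"
    by blast
qed

lemma E_null_mult:
  assumes "F \<in> E_null" "G \<in> E_M"
  shows "(\<lambda>\<phi> x. F \<phi> x * G \<phi> x) \<in> E_null"
  unfolding E_null_def mem_Collect_eq
proof (intro conjI allI impI; (elim conjE)?)
  show "(\<lambda>\<phi> x. F \<phi> x * G \<phi> x) \<in> E_basic"
    using assms by (intro E_basic_mult E_M_basic E_null_basic)
  fix K :: "real set" and p assume K: "compact K" "K \<noteq> {}"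
  obtain a where a:
    "\<And>i r \<phi>. i \<le> p \<Longrightarrow> a \<le> r \<Longrightarrow> \<phi> \<in> A_test r \<Longrightarrow>
       sup_deriv F K i \<phi> \<in> O[at_right 0](\<lambda>\<epsilon>. \<epsilon> ^ (r - a))"
    using E_null_uniform[OF assms(1) K] by blast
  obtain b where b:
    "\<And>i \<phi>. i \<le> p \<Longrightarrow> \<phi> \<in> A_test b \<Longrightarrow> sup_deriv G K i \<phi> \<in> O[at_right 0](\<lambda>\<epsilon>. 1 / \<epsilon> ^ b)"
    using E_M_uniform[OF assms(2) K] by blast
  have "sup_deriv (\<lambda>\<phi> x. F \<phi> x * G \<phi> x) K p \<phi> \<in> O[at_right 0](\<lambda>\<epsilon>. \<epsilon> ^ (r - (a + b)))"
    if r: "a + b \<le> r" and "\<phi> \<in> A_test r" for \<phi> r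
  proof -
    have in_A: "\<phi> \<in> A_test 0" "\<phi> \<in> A_test b"
      using that A_antimono[THEN subsetD, of _ r \<phi>] by auto
    have "sup_deriv (\<lambda>\<phi> x. F \<phi> x * G \<phi> x) K p \<phi> \<in> O[at_right 0](\<lambda>\<epsilon>. \<epsilon> ^ (r - a) * (1 / \<epsilon> ^ b))"
    proof (rule sup_deriv_mult_bigo)
      show "sup_deriv F K i \<phi> \<in> O[at_right 0](\<lambda>\<epsilon>. \<epsilon> ^ (r - a))" if "i \<le> p" for i
        using \<open>\<phi> \<in> A_test r\<close> r that by (intro a) auto
      show "sup_deriv G K i \<phi> \<in> O[at_right 0](\<lambda>\<epsilon>. 1 / \<epsilon> ^ b)" if "i \<le> p" for i
        using in_A that by (intro b)
    qed (use assms K in_A in \<open>auto intro: E_M_basic E_null_basic\<close>)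
    moreover have "\<forall>\<^sub>F \<epsilon> in at_right 0. \<epsilon> ^ (r - a) * (1 / \<epsilon> ^ b) = (\<epsilon>::real) ^ (r - (a + b))"
      using eventually_at_right_less[of 0]
    proof eventually_elim
      case (elim \<epsilon>)
      have "r - a = (r - (a + b)) + b" using r by simp
      then have "\<epsilon> ^ (r - a) = \<epsilon> ^ (r - (a + b)) * \<epsilon> ^ b" by (metis power_add)
      with elim show ?case by simp
    qed
    then have "O[at_right 0](\<lambda>\<epsilon>. \<epsilon> ^ (r - a) * (1 / \<epsilon> ^ b)) =
        O[at_right 0](\<lambda>\<epsilon>::real. \<epsilon> ^ (r - (a + b)))"
      by (rule landau_o.big.cong)
    ultimately show ?thesis by simp
  qed
  then show "\<exists>q. \<forall>r\<ge>q. \<forall>\<phi>\<in>A_test r.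
      sup_deriv (\<lambda>\<phi> x. F \<phi> x * G \<phi> x) K p \<phi> \<in> O[at_right 0](\<lambda>\<epsilon>. \<epsilon> ^ (r - q))"
    by blast
qed

lemma E_null_diff:
  assumes "F \<in> E_null" "G \<in> E_null"
  shows "(\<lambda>\<phi> x. F \<phi> x - G \<phi> x) \<in> E_null"
  unfolding E_null_def mem_Collect_eq
proof (intro conjI allI impI; (elim conjE)?)
  show "(\<lambda>\<phi> x. F \<phi> x - G \<phi> x) \<in> E_basic"
    using assms by (intro E_basic_diff E_null_basic)
  fix K :: "real set" and p assume K: "compact K" "K \<noteq> {}"
  obtain a where a:
    "\<And>r \<phi>. a \<le> r \<Longrightarrow> \<phi> \<in> A_test r \<Longrightarrow> sup_deriv F K p \<phi> \<in> O[at_right 0](\<lambda>\<epsilon>. \<epsilon> ^ (r - a))"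
    using assms(1) K unfolding E_null_def mem_Collect_eq by meson
  obtain b where b:
    "\<And>r \<phi>. b \<le> r \<Longrightarrow> \<phi> \<in> A_test r \<Longrightarrow> sup_deriv G K p \<phi> \<in> O[at_right 0](\<lambda>\<epsilon>. \<epsilon> ^ (r - b))"
    using assms(2) K unfolding E_null_def mem_Collect_eq by meson
  have "sup_deriv (\<lambda>\<phi> x. F \<phi> x - G \<phi> x) K p \<phi> \<in> O[at_right 0](\<lambda>\<epsilon>. \<epsilon> ^ (r - (a + b)))"
    if r: "a + b \<le> r" and "\<phi> \<in> A_test r" for \<phi> r
  proof (intro sup_deriv_diff_bigo)
    show "sup_deriv F K p \<phi> \<in> O[at_right 0](\<lambda>\<epsilon>. \<epsilon> ^ (r - (a + b)))"
      using that by (intro landau_o.big_trans[OF a power_bigo]) auto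
    show "sup_deriv G K p \<phi> \<in> O[at_right 0](\<lambda>\<epsilon>. \<epsilon> ^ (r - (a + b)))"
      using that by (intro landau_o.big_trans[OF b power_bigo]) auto
  qed (use assms K that A_antimono[THEN subsetD, of 0 r \<phi>] in \<open>auto intro: E_null_basic\<close>)
  then show "\<exists>q. \<forall>r\<ge>q. \<forall>\<phi>\<in>A_test r.
      sup_deriv (\<lambda>\<phi> x. F \<phi> x - G \<phi> x) K p \<phi> \<in> O[at_right 0](\<lambda>\<epsilon>. \<epsilon> ^ (r - q))"
    by blast
qed

lemma zero_in_E_null: "(\<lambda>\<phi> x. 0) \<in> E_null"
proof -
  have "sup_deriv (\<lambda>\<phi> x. 0) K p \<phi> = (\<lambda>\<epsilon>. 0)" if "K \<noteq> {}" for K p \<phi>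
    using that by (simp add: sup_deriv_def vderiv_funpow_zero)
  then show ?thesis by (auto simp: E_null_def E_basic_def smooth_zero)
qed

lemma zero_in_E_M: "(\<lambda>\<phi> x. 0) \<in> E_M"
proof -
  have "sup_deriv (\<lambda>\<phi> x. 0) K p \<phi> = (\<lambda>\<epsilon>. 0)" if "K \<noteq> {}" for K p \<phi>
    using that by (simp add: sup_deriv_def vderiv_funpow_zero)
  then show ?thesis by (auto simp: E_M_def E_basic_def smooth_zero)
qed

lemma E_null_uminus: "F \<in> E_null \<Longrightarrow> (\<lambda>\<phi> x. - F \<phi> x) \<in> E_null"
  using E_null_diff[OF zero_in_E_null] by simp

lemma E_null_add:
  assumes "F \<in> E_null" "G \<in> E_null"
  shows "(\<lambda>\<phi> x. F \<phi> x + G \<phi> x) \<in> E_null"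
  using E_null_diff[OF assms(1) E_null_uminus[OF assms(2)]] by simp

lemma colombeau_eq_refl: "F \<in> E_M \<Longrightarrow> colombeau_eq F F"
  by (simp add: colombeau_eq_def zero_in_E_null)

lemma colombeau_eq_sym: "colombeau_eq F G \<Longrightarrow> colombeau_eq G F"
  using E_null_uminus[of "\<lambda>\<phi> x. F \<phi> x - G \<phi> x"] by (simp add: colombeau_eq_def)

lemma colombeau_eq_trans: "colombeau_eq F G \<Longrightarrow> colombeau_eq G H \<Longrightarrow> colombeau_eq F H"
  using E_null_add[of "\<lambda>\<phi> x. F \<phi> x - G \<phi> x" "\<lambda>\<phi> x. G \<phi> x - H \<phi> x"]
  by (simp add: colombeau_eq_def)

lemma colombeau_eq_mult:
  assumes "colombeau_eq F F'" "colombeau_eq G G'"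
  shows "colombeau_eq (\<lambda>\<phi> x. F \<phi> x * G \<phi> x) (\<lambda>\<phi> x. F' \<phi> x * G' \<phi> x)"
proof -
  have "(\<lambda>\<phi> x. (F \<phi> x - F' \<phi> x) * G \<phi> x + (G \<phi> x - G' \<phi> x) * F' \<phi> x) \<in> E_null"
    using assms by (intro E_null_add E_null_mult) (auto simp: colombeau_eq_def)
  then have "(\<lambda>\<phi> x. F \<phi> x * G \<phi> x - F' \<phi> x * G' \<phi> x) \<in> E_null"
    by (simp add: algebra_simps)
  with assms show ?thesis by (simp add: colombeau_eq_def E_M_mult)
qed

lemma colombeau_eq_dx:
  assumes "colombeau_eq F G"
  shows "colombeau_eq (dx F) (dx G)"
proof -
  have FG: "F \<in> E_M" "G \<in> E_M" "(\<lambda>\<phi> x. F \<phi> x - G \<phi> x) \<in> E_null"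
    using assms by (auto simp: colombeau_eq_def)
  let ?H = "\<lambda>\<phi> x. dx F \<phi> x - dx G \<phi> x"
  have eq: "dx (\<lambda>\<phi> x. F \<phi> x - G \<phi> x) \<phi> = ?H \<phi>" if "\<phi> \<in> A_test 0" for \<phi>
    using FG that unfolding dx_def
    by (intro vderiv_diff smooth_differentiable) (auto simp: E_M_def E_basic_def)
  have "?H \<in> E_basic"
    using FG by (intro E_basic_diff E_basic_dx E_M_basic)
  moreover have "sup_deriv ?H K p \<phi> \<in> O[at_right 0](h) \<longleftrightarrow>
      sup_deriv (dx (\<lambda>\<phi> x. F \<phi> x - G \<phi> x)) K p \<phi> \<in> O[at_right 0](h)"
    if "\<phi> \<in> A_test r" for \<phi> h K p r
  proof (rule landau_o.big.in_cong)
    have "\<phi> \<in> A_test 0" using that A_antimono[THEN subsetD, of 0 r \<phi>] by auto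
    then show "\<forall>\<^sub>F \<epsilon> in at_right 0. sup_deriv ?H K p \<phi> \<epsilon> =
        sup_deriv (dx (\<lambda>\<phi> x. F \<phi> x - G \<phi> x)) K p \<phi> \<epsilon>"
      using eventually_at_right_less[of 0]
      by (auto elim!: eventually_mono simp: sup_deriv_def eq scaled_in_A)
  qed
  ultimately have "?H \<in> E_null"
    using E_null_dx[OF FG(3)] by (simp add: E_null_def)
  with FG show ?thesis by (simp add: colombeau_eq_def E_M_dx)
qed


subsection \<open>The quotient\<close>

quotient_type colombeau = representative / partial: colombeau_eq
  morphisms colombeau_rep colombeau_class
proof (rule part_equivpI)
  show "\<exists>F. colombeau_eq F F" using colombeau_eq_refl zero_in_E_M by blast
  show "symp colombeau_eq" by (blast intro: sympI colombeau_eq_sym)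
  show "transp colombeau_eq" by (blast intro: transpI colombeau_eq_trans)
qed

instantiation colombeau :: times
begin

lift_definition times_colombeau :: "colombeau \<Rightarrow> colombeau \<Rightarrow> colombeau"
  is "\<lambda>F G \<phi> x. F \<phi> x * G \<phi> x"
  by (rule colombeau_eq_mult)

instance ..

end

lift_definition colombeau_deriv :: "colombeau \<Rightarrow> colombeau" is dx
  by (rule colombeau_eq_dx)


section \<open>Distributions and association\<close>

text \<open>
  Distributions are functionals on all functions, of which only the values on
  \<^const>\<open>test_funs\<close> matter.
\<close>

definition distribution :: "((real \<Rightarrow> complex) \<Rightarrow> complex) \<Rightarrow> bool" where
  "distribution u \<longleftrightarrow>
     (\<forall>\<psi>\<in>test_funs. \<forall>\<xi>\<in>test_funs. u (\<lambda>x. \<psi> x + \<xi> x) = u \<psi> + u \<xi>) \<and>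
     (\<forall>c. \<forall>\<psi>\<in>test_funs. u (\<lambda>x. c * \<psi> x) = c * u \<psi>) \<and>
     (\<forall>K. compact K \<longrightarrow> (\<exists>C N. \<forall>\<psi>\<in>test_funs. {x. \<psi> x \<noteq> 0} \<subseteq> K \<longrightarrow>
        norm (u \<psi>) \<le> C * (\<Sum>k\<le>N. SUP x. norm ((vderiv ^^ k) \<psi> x))))"

definition dirac :: "(real \<Rightarrow> complex) \<Rightarrow> complex" where
  "dirac \<psi> = \<psi> 0"

definition dist_deriv :: "((real \<Rightarrow> complex) \<Rightarrow> complex) \<Rightarrow> (real \<Rightarrow> complex) \<Rightarrow> complex" where
  "dist_deriv u \<psi> = - u (vderiv \<psi>)"

definition associated :: "colombeau \<Rightarrow> ((real \<Rightarrow> complex) \<Rightarrow> complex) \<Rightarrow> bool" (infix "\<approx>\<^sub>D" 50) where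
  "g \<approx>\<^sub>D u \<longleftrightarrow> distribution u \<and>
     (\<exists>G\<in>E_M. colombeau_class G = g \<and>
       (\<forall>\<psi>\<in>test_funs. \<exists>q. \<forall>\<phi>\<in>A_test q.
          ((\<lambda>\<epsilon>. LINT x|lborel. G (scaled \<epsilon> \<phi>) x * \<psi> x) \<longlongrightarrow> u \<psi>) (at_right 0)))"


section \<open>Modelling of singularities\<close>

text \<open>
  The values of \<open>D\<close> are complex: for real-valued \<open>D\<close> the normalisations force the functions
  \<open>D_sigma D s\<close> to have norm 1 in \<open>L\<^sup>2\<close>, so they could not approximate the Dirac distribution
  as \<open>s \<rightarrow> 0\<close>.
\<close>

definition delta_modelling :: "(real \<Rightarrow> real \<Rightarrow> complex) \<Rightarrow> bool" where
  "delta_modelling D \<longleftrightarrow> (\<forall>s>0.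
     D s \<in> test_funs \<and> (\<forall>x. D s (- x) = D s x) \<and>
     (1 / of_real s) * (LINT x|lborel. (D s x)\<^sup>2) = 1 \<and> (LINT x|lborel. D s x) = 1)"

text \<open>
  Without a bound of this kind \<open>D_sigma D s\<close> need not concentrate at the origin as \<open>s \<rightarrow> 0\<close>.
  For instance \<open>D s x = s * g (s * x)\<close>, with \<open>g\<close> an even test function such that
  \<open>\<integral>g = \<integral>g\<^sup>2 = 1\<close>, satisfies \<^const>\<open>delta_modelling\<close>, but \<open>D_sigma D s = g\<close> for all \<open>s\<close>.
  The bounds cannot be required for all \<open>s > 0\<close>, since \<open>\<integral>(D s)\<^sup>2 = s\<close>.
\<close>

definition uniformly_localized :: "(real \<Rightarrow> real \<Rightarrow> complex) \<Rightarrow> bool" where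
  "uniformly_localized D \<longleftrightarrow> (\<exists>l C. \<forall>\<^sub>F s in at_right 0.
     (\<forall>x. \<bar>x\<bar> > l \<longrightarrow> D s x = 0) \<and> (LINT x|lborel. (norm (D s x))\<^sup>2) \<le> C)"

definition D_sigma :: "(real \<Rightarrow> real \<Rightarrow> complex) \<Rightarrow> real \<Rightarrow> real \<Rightarrow> complex" where
  "D_sigma D \<sigma> = (\<lambda>x. D \<sigma> (x / \<sigma>) / of_real \<sigma>)"

definition delta_rep :: "(real \<Rightarrow> real \<Rightarrow> complex) \<Rightarrow> representative" where
  "delta_rep D = (\<lambda>\<phi>. D_sigma D (supp_radius \<phi>))"

definition convolution :: "(real \<Rightarrow> complex) \<Rightarrow> (real \<Rightarrow> complex) \<Rightarrow> real \<Rightarrow> complex" where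
  "convolution f g = (\<lambda>x. LINT y|lborel. f y * g (x - y))"

definition model_rep :: "(real \<Rightarrow> real \<Rightarrow> complex) \<Rightarrow> (real \<Rightarrow> complex) \<Rightarrow> representative" where
  "model_rep D f = (\<lambda>\<phi>. convolution f (D_sigma D (supp_radius \<phi>)))"

text \<open>
  Elements of \<open>C_d k\<close> are total functions, but \<open>f 0\<close> is unconstrained and irrelevant.
\<close>

definition C_d :: "nat \<Rightarrow> (real \<Rightarrow> complex) set" where
  "C_d k = {f. (\<forall>i<k. \<forall>x. x \<noteq> 0 \<longrightarrow> (vderiv ^^ i) f differentiable at x) \<and>
     (\<forall>i\<le>k. (\<exists>l. ((vderiv ^^ i) f \<longlongrightarrow> l) (at_right 0)) \<and>
             (\<exists>l. ((vderiv ^^ i) f \<longlongrightarrow> l) (at_left 0)))}"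

definition m_coeff :: "(real \<Rightarrow> complex) \<Rightarrow> nat \<Rightarrow> complex" where
  "m_coeff f i = (1 / 2) * (Lim (at_right 0) ((vderiv ^^ i) f) + Lim (at_left 0) ((vderiv ^^ i) f))"

definition h_coeff :: "(real \<Rightarrow> complex) \<Rightarrow> nat \<Rightarrow> complex" where
  "h_coeff f i = Lim (at_right 0) ((vderiv ^^ i) f) - Lim (at_left 0) ((vderiv ^^ i) f)"

end

theory Submission
  imports Defs
begin

text \<open>
  Write \<open>E = D\<^sub>\<sigma>\<close>. Only \<open>E\<close> itself, not its derivatives, is controlled as \<open>\<sigma> \<rightarrow> 0\<close>, so both derivatives are
  first moved from \<open>E''\<close> to \<open>(f * E) \<psi>\<close>. Each derivative of a convolution with a piecewise smooth
  function \<open>g\<close> with jump \<open>h\<close> at \<open>0\<close> produces an extra term, \<open>(g * E)' = h E + g' * E\<close>; hence \<open>(f * E)'' = h\<^sub>0 E' + h\<^sub>1 E + f'' * E\<close>,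
  and \<open>E' E = (E\<^sup>2)' / 2\<close>. The integral thus becomes a combination of integrals of \<open>E\<^sup>2 \<xi>\<close> and
  \<open>(g * E) E \<xi>\<close>. The former tend to \<open>\<xi>(0)\<close>: \<open>E\<^sup>2\<close> is even with integral \<open>1\<close>, and
  \<open>\<sigma> \<integral>|E|\<^sup>2\<close> is bounded. The latter tend to \<open>m \<xi>(0)\<close> with \<open>m\<close> the mean of the one-sided limits
  of \<open>g\<close>: since \<open>E\<close> is even, \<open>g\<close> may be replaced by \<open>(g(y) + g(-y)) / 2\<close>, which tends to \<open>m\<close>.
\<close>

section \<open>Test functions\<close>

lemma smooth_has_vderiv: "smooth g \<Longrightarrow> (g has_vector_derivative vderiv g x) (at x)"
  using smooth_differentiable vector_derivative_works unfolding vderiv_def by blast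

lemma smooth_isCont: "smooth g \<Longrightarrow> isCont g x"
  using smooth_differentiable differentiable_imp_continuous_within by blast

lemma vderiv_eqI: "(\<And>x. (g has_vector_derivative g' x) (at x)) \<Longrightarrow> vderiv g = g'"
  by (auto simp: vderiv_def vector_derivative_at)

lemma test_funs_smooth: "\<theta> \<in> test_funs \<Longrightarrow> smooth \<theta>"
  by (simp add: test_funs_def)

lemma test_funs_isCont: "\<theta> \<in> test_funs \<Longrightarrow> isCont \<theta> x"
  by (simp add: smooth_isCont test_funs_smooth)

lemma test_funs_iff: "\<theta> \<in> test_funs \<longleftrightarrow> smooth \<theta> \<and> (\<exists>R>0. \<forall>x. \<bar>x\<bar> > R \<longrightarrow> \<theta> x = 0)"
proof -
  have "bounded {x. \<theta> x \<noteq> 0} \<longleftrightarrow> (\<exists>R>0. \<forall>x. \<bar>x\<bar> > R \<longrightarrow> \<theta> x = 0)"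
    unfolding bounded_pos by (auto simp: not_less[symmetric])
  then show ?thesis by (simp add: test_funs_def)
qed

lemma test_funs_supportE:
  assumes "\<theta> \<in> test_funs"
  obtains R where "R > 0" "\<And>x. \<bar>x\<bar> > R \<Longrightarrow> \<theta> x = 0"
  using assms by (auto simp: test_funs_iff)

text \<open>The region beyond \<open>R\<close> is open, so a function vanishing there is locally
  constant at each of its points. Hence every derivative inherits the same \<open>R\<close>, strict
  inequality included.\<close>

lemma vderiv_funpow_eq_0_outside:
  assumes "\<And>x. \<bar>x\<bar> > R \<Longrightarrow> \<theta> x = 0" "\<bar>x\<bar> > R"
  shows "(vderiv ^^ k) \<theta> x = 0"
  using assms(2)
proof (induction k arbitrary: x)
  case (Suc k)
  have "open {x::real. \<bar>x\<bar> > R}"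
    by (intro open_Collect_less continuous_intros)
  then have "((vderiv ^^ k) \<theta> has_vector_derivative 0) (at x)"
    using Suc by (intro has_vector_derivative_transform_within_open[OF has_vector_derivative_const]) auto
  then have "vderiv ((vderiv ^^ k) \<theta>) x = 0"
    unfolding vderiv_def by (rule vector_derivative_at)
  then show ?case by simp
qed (use assms in auto)

lemma test_funs_vderiv: "\<theta> \<in> test_funs \<Longrightarrow> vderiv \<theta> \<in> test_funs"
  unfolding test_funs_iff using smooth_vderiv vderiv_funpow_eq_0_outside[where k = 1]
  by (metis funpow.simps(1,2) One_nat_def comp_id)

lemma test_funs_vderiv_funpow: "\<theta> \<in> test_funs \<Longrightarrow> (vderiv ^^ k) \<theta> \<in> test_funs"
  by (induction k) (auto intro: test_funs_vderiv)

lemma test_funs_add: "\<theta> \<in> test_funs \<Longrightarrow> \<eta> \<in> test_funs \<Longrightarrow> (\<lambda>x. \<theta> x + \<eta> x) \<in> test_funs"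
proof -
  assume *: "\<theta> \<in> test_funs" "\<eta> \<in> test_funs"
  obtain R S where "R > 0" "\<And>x. \<bar>x\<bar> > R \<Longrightarrow> \<theta> x = 0" "S > 0" "\<And>x. \<bar>x\<bar> > S \<Longrightarrow> \<eta> x = 0"
    using * by (meson test_funs_supportE)
  with * show ?thesis
    unfolding test_funs_iff by (intro conjI smooth_add exI[of _ "max R S"]) auto
qed

lemma test_funs_mult: "smooth \<theta> \<Longrightarrow> \<eta> \<in> test_funs \<Longrightarrow> (\<lambda>x. \<theta> x * \<eta> x) \<in> test_funs"
  unfolding test_funs_iff by (auto intro: smooth_mult)

lemma smooth_const: "smooth (\<lambda>x. c)"
proof -
  have "vderiv (\<lambda>x. c) = (\<lambda>x. 0)" by (simp add: vderiv_def)
  moreover have "smooth_upto n (\<lambda>x::real. 0::complex)" for n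
    using smooth_zero smooth_iff_upto by blast
  ultimately have "smooth_upto n (\<lambda>x. c)" for n
    by (cases n) (auto simp: smooth_upto_0 smooth_upto_Suc)
  then show ?thesis by (simp add: smooth_iff_upto)
qed

lemma test_funs_cmult: "\<theta> \<in> test_funs \<Longrightarrow> (\<lambda>x. c * \<theta> x) \<in> test_funs"
  by (rule test_funs_mult[OF smooth_const])

lemma test_funs_bounded:
  assumes "\<theta> \<in> test_funs"
  obtains B where "B > 0" "\<And>x. norm (\<theta> x) \<le> B"
proof -
  obtain R where R: "R > 0" "\<And>x. \<bar>x\<bar> > R \<Longrightarrow> \<theta> x = 0"
    using assms by (rule test_funs_supportE) blast
  have "compact (\<theta> ` {-R..R})"
    by (intro compact_continuous_image continuous_at_imp_continuous_on ballI test_funs_isCont assms) auto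
  then obtain B where "B > 0" "\<And>x. \<bar>x\<bar> \<le> R \<Longrightarrow> norm (\<theta> x) \<le> B"
    by (auto dest!: compact_imp_bounded simp: bounded_pos abs_le_iff minus_le_iff)
  then have "norm (\<theta> x) \<le> B" for x using R(2)[of x] \<open>B > 0\<close> by (cases "\<bar>x\<bar> > R") auto
  then show ?thesis using that \<open>B > 0\<close> by blast
qed


section \<open>Piecewise continuous functions\<close>

text \<open>The value at \<open>0\<close> is left free: derivatives of a function in
  \<open>C_d\<close> have arbitrary values there, since \<open>vderiv\<close> is total. Smooth
  functions belong to the class too, so one set of integrability facts serves every
  integrand.\<close>

definition pw_cont :: "(real \<Rightarrow> complex) \<Rightarrow> bool" where
  "pw_cont g \<longleftrightarrow> (\<forall>x. x \<noteq> 0 \<longrightarrow> isCont g x) \<and>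
     (\<exists>l. (g \<longlongrightarrow> l) (at_right 0)) \<and> (\<exists>l. (g \<longlongrightarrow> l) (at_left 0))"

lemma pw_cont_mult: "pw_cont g \<Longrightarrow> pw_cont k \<Longrightarrow> pw_cont (\<lambda>x. g x * k x)"
  unfolding pw_cont_def by (blast intro: tendsto_mult continuous_mult)

lemma pw_cont_add: "pw_cont g \<Longrightarrow> pw_cont k \<Longrightarrow> pw_cont (\<lambda>x. g x + k x)"
  unfolding pw_cont_def by (blast intro: tendsto_add continuous_add)

lemma pw_cont_diff: "pw_cont g \<Longrightarrow> pw_cont k \<Longrightarrow> pw_cont (\<lambda>x. g x - k x)"
  unfolding pw_cont_def by (blast intro: tendsto_diff continuous_diff)

lemma pw_cont_isCont: "(\<And>x. isCont g x) \<Longrightarrow> pw_cont g"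
  unfolding pw_cont_def
  by (meson UNIV_I continuous_at_imp_continuous_at_within continuous_within)

lemma pw_cont_measurable: "pw_cont g \<Longrightarrow> g \<in> borel_measurable borel"
  by (rule borel_measurable_continuous_countable_exceptions[of "{0}"])
     (auto simp: pw_cont_def intro!: continuous_at_imp_continuous_on)

text \<open>The one-sided limits bound \<open>g\<close> on punctured half-neighbourhoods of
  \<open>0\<close>, compactness bounds it on the rest of the interval, and the point
  \<open>0\<close> contributes its own value.\<close>

lemma pw_cont_bounded:
  assumes "pw_cont g"
  obtains B where "B > 0" "\<And>x. \<bar>x\<bar> \<le> R \<Longrightarrow> norm (g x) \<le> B"
proof -
  have bd: "\<exists>d>0. \<exists>B. \<forall>x\<in>S. \<bar>x\<bar> < d \<and> x \<noteq> 0 \<longrightarrow> norm (g x) \<le> B" if "(g \<longlongrightarrow> l) (at 0 within S)" for l S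
  proof -
    have "\<forall>\<^sub>F x in at 0 within S. dist (g x) l < 1" using that by (rule tendstoD) auto
    then obtain d where "d > 0" "\<And>x. x \<in> S \<Longrightarrow> \<bar>x\<bar> < d \<Longrightarrow> x \<noteq> 0 \<Longrightarrow> dist (g x) l < 1"
      by (auto simp: eventually_at)
    moreover have "norm (g x) \<le> norm l + 1" if "dist (g x) l < 1" for x
      using that norm_triangle_ineq[of l "g x - l"] by (simp add: dist_norm)
    ultimately show ?thesis by blast
  qed
  obtain l r where lr: "(g \<longlongrightarrow> l) (at_left 0)" "(g \<longlongrightarrow> r) (at_right 0)"
    using assms unfolding pw_cont_def by blast
  obtain d B where d: "d > 0" "\<And>x. x > 0 \<Longrightarrow> \<bar>x\<bar> < d \<Longrightarrow> norm (g x) \<le> B"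
    using bd[OF lr(2)] by auto
  obtain e C where e: "e > 0" "\<And>x. x < 0 \<Longrightarrow> \<bar>x\<bar> < e \<Longrightarrow> norm (g x) \<le> C"
    using bd[OF lr(1)] by auto
  define K where "K = {d..R} \<union> {-R..-e}"
  have "compact (g ` K)"
    using assms d(1) e(1) unfolding K_def pw_cont_def
    by (intro compact_continuous_image continuous_at_imp_continuous_on ballI compact_Un) auto
  then obtain A where A: "\<And>x. x \<in> K \<Longrightarrow> norm (g x) \<le> A"
    by (metis compact_imp_bounded bounded_pos imageI)
  show ?thesis
  proof (rule that)
    show "1 + \<bar>A\<bar> + \<bar>B\<bar> + \<bar>C\<bar> + norm (g 0) > 0" using norm_ge_zero[of "g 0"] by linarith
    fix x assume x: "\<bar>x\<bar> \<le> R"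
    consider "x = 0" | "x > 0" "\<bar>x\<bar> < d" | "x < 0" "\<bar>x\<bar> < e" | "x \<in> K"
      using x unfolding K_def Un_iff atLeastAtMost_iff by linarith
    then show "norm (g x) \<le> 1 + \<bar>A\<bar> + \<bar>B\<bar> + \<bar>C\<bar> + norm (g 0)"
    proof cases
      case 1
      then show ?thesis by simp
    next
      case 2
      then show ?thesis using d(2)[of x] norm_ge_zero[of "g 0"] by linarith
    next
      case 3
      then show ?thesis using e(2)[of x] norm_ge_zero[of "g 0"] by linarith
    next
      case 4
      then show ?thesis using A[of x] norm_ge_zero[of "g 0"] by linarith
    qed
  qed
qed

section \<open>Integrals of compactly supported functions and the fundamental theorem with a
  jump\<close>

lemma pw_cont_integrable:
  assumes "pw_cont g" "\<And>x. \<bar>x\<bar> > R \<Longrightarrow> g x = 0"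
  shows "integrable lborel g"
proof -
  obtain B where B: "\<And>x. \<bar>x\<bar> \<le> R \<Longrightarrow> norm (g x) \<le> B" using pw_cont_bounded[OF assms(1)] by metis
  have [measurable]: "g \<in> borel_measurable lborel" using pw_cont_measurable[OF assms(1)] by simp
  show ?thesis
    by (rule integrableI_bounded_set[where A = "cbox (-R) R" and B = B])
       (use B assms(2) in \<open>auto intro!: AE_I2 simp: emeasure_lborel_Icc_eq\<close>)
qed

lemma test_funs_integrable:
  assumes "pw_cont g" "\<theta> \<in> test_funs"
  shows "integrable lborel (\<lambda>x. g x * \<theta> x)"
proof -
  obtain R where "\<And>x. \<bar>x\<bar> > R \<Longrightarrow> \<theta> x = 0"
    using assms(2) by (rule test_funs_supportE) blast
  then show ?thesis
    using assms
    by (intro pw_cont_integrable[where R = R] pw_cont_mult pw_cont_isCont[of \<theta>] test_funs_isCont) auto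
qed

lemma norm_integral_le:
  fixes g :: "real \<Rightarrow> complex"
  assumes "\<And>x. \<bar>x - a\<bar> \<le> R \<Longrightarrow> norm (g x) \<le> B" "\<And>x. \<bar>x - a\<bar> > R \<Longrightarrow> g x = 0" "R \<ge> 0"
  shows "norm (LINT x|lborel. g x) \<le> 2 * R * B"
proof (cases "integrable lborel g")
  case True
  have "norm (LINT x|lborel. g x) \<le> (LINT x|lborel. indicator {a-R..a+R} x * B)"
  proof (rule Bochner_Integration.integral_norm_bound_integral[OF True])
    show "integrable lborel (\<lambda>x. indicator {a-R..a+R} x * B)"
      by (intro integrable_mult_left integrable_real_indicator) (auto simp: emeasure_lborel_Icc_eq)
    show "norm (g x) \<le> indicator {a-R..a+R} x * B" for x
      using assms(1,2)[of x] by (cases "\<bar>x - a\<bar> \<le> R") (auto simp: indicator_def abs_le_iff)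
  qed
  also have "\<dots> = 2 * R * B" using assms(3) by simp
  finally show ?thesis .
next
  case False
  \<comment> \<open>A non-integrable function has integral 0 by convention, so only
    \<open>0 <= B\<close> is left, and the bound at the centre \<open>a\<close> gives it. The
    estimate can therefore be applied without checking integrability.\<close>
  have "0 \<le> B" using assms(1)[of a] assms(3) order_trans[OF norm_ge_zero] by simp
  with False show ?thesis using assms(3) by (simp add: not_integrable_integral_eq)
qed

text \<open>The fundamental theorem of calculus is applied on each half-line. The ends at infinity
  contribute nothing because of the support, and the one-sided limits at \<open>0\<close> remain.
  Every jump coefficient \<open>h_coeff\<close> in the result originates here.\<close>

lemma integral_deriv_jump:
  assumes w: "pw_cont w" and w': "pw_cont w'"
    and deriv: "\<And>x. x \<noteq> 0 \<Longrightarrow> (w has_vector_derivative w' x) (at x)"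
    and supp: "\<And>x. \<bar>x\<bar> > R \<Longrightarrow> w x = 0" "\<And>x. \<bar>x\<bar> > R \<Longrightarrow> w' x = 0"
  shows "(LINT x|lborel. w' x) = Lim (at_left 0) w - Lim (at_right 0) w"
proof -
  have int: "integrable lborel w'" by (rule pw_cont_integrable[OF w' supp(2)])
  obtain l r where lr: "(w \<longlongrightarrow> l) (at_left 0)" "(w \<longlongrightarrow> r) (at_right 0)"
    using w by (auto simp: pw_cont_def)
  have si: "set_integrable lborel A w'" if "A \<in> sets borel" for A
    using that int unfolding set_integrable_def by (intro integrable_mult_indicator) auto
  have "(LBINT x=0..\<infinity>. w' x) = 0 - r"
  proof (rule interval_integral_FTC_integrable)
    show "isCont w' x" if "0 < ereal x" for x using that w' by (auto simp: pw_cont_def)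
    show "((w \<circ> real_of_ereal) \<longlongrightarrow> r) (at_right 0)"
      using lr(2) by (simp add: ereal_tendsto_simps zero_ereal_def)
    have "\<forall>\<^sub>F x in at_top. w x = 0"
      using eventually_gt_at_top[of "max 0 R"] by eventually_elim (auto intro!: supp)
    then show "((w \<circ> real_of_ereal) \<longlongrightarrow> 0) (at_left \<infinity>)"
      by (simp add: ereal_tendsto_simps tendsto_eventually)
  qed (auto intro!: deriv si)
  moreover have "(LBINT x=-\<infinity>..0. w' x) = l - 0"
  proof (rule interval_integral_FTC_integrable)
    show "isCont w' x" if "ereal x < 0" for x using that w' by (auto simp: pw_cont_def)
    show "((w \<circ> real_of_ereal) \<longlongrightarrow> l) (at_left 0)"
      using lr(1) by (simp add: ereal_tendsto_simps zero_ereal_def)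
    have "\<forall>\<^sub>F x in at_bot. w x = 0"
      using eventually_le_at_bot[of "min 0 (-R) - 1"] by eventually_elim (auto intro!: supp)
    then show "((w \<circ> real_of_ereal) \<longlongrightarrow> 0) (at_right (-\<infinity>))"
      by (simp add: ereal_tendsto_simps tendsto_eventually)
  qed (auto intro!: deriv si)
  moreover have "(LBINT x=-\<infinity>..0. w' x) + (LBINT x=0..\<infinity>. w' x) = (LBINT x=-\<infinity>..\<infinity>. w' x)"
    using int by (intro interval_integral_sum) (auto simp: interval_lebesgue_integrable_def set_integrable_def)
  moreover have "(LBINT x=-\<infinity>..\<infinity>. w' x) = (LINT x|lborel. w' x)"
    by (simp add: interval_integral_to_infinity_eq interval_lebesgue_integral_def set_lebesgue_integral_def einterval_def)
  moreover have "Lim (at_left 0) w = l" "Lim (at_right 0) w = r"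
    using lr by (auto intro: tendsto_Lim)
  ultimately show ?thesis by simp
qed

lemma integral_vderiv_test_funs:
  assumes "\<theta> \<in> test_funs"
  shows "(LINT x|lborel. vderiv \<theta> x) = 0"
proof -
  obtain R where R: "\<And>x. \<bar>x\<bar> > R \<Longrightarrow> \<theta> x = 0" using assms by (rule test_funs_supportE) blast
  have lim: "Lim (at 0 within S) \<theta> = \<theta> 0" if "at 0 within S \<noteq> bot" for S
    using that test_funs_isCont[OF assms, of 0]
    by (intro tendsto_Lim) (auto simp: isCont_def intro: tendsto_within_subset)
  have "(LINT x|lborel. vderiv \<theta> x) = Lim (at_left 0) \<theta> - Lim (at_right 0) \<theta>"
  proof (rule integral_deriv_jump[where R = R])
    show "vderiv \<theta> x = 0" if "\<bar>x\<bar> > R" for x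
      using vderiv_funpow_eq_0_outside[where k = 1] R that by force
  qed (use R assms in \<open>auto intro!: pw_cont_isCont test_funs_isCont test_funs_vderiv
        smooth_has_vderiv test_funs_smooth\<close>)
  then show ?thesis by (simp add: lim)
qed

text \<open>The remainder constant is uniform in both points, which is what differentiation under a
  convolution integral requires. It comes from applying the linearization bound twice, first to the
  derivative and then to the function.\<close>

lemma test_funs_taylor:
  assumes "\<theta> \<in> test_funs"
  obtains M where "M > 0" "\<And>a b. norm (\<theta> b - \<theta> a - (b - a) *\<^sub>R vderiv \<theta> a) \<le> M * (b - a)\<^sup>2"
proof -
  obtain B where B: "B > 0" "\<And>x. norm ((vderiv ^^ 2) \<theta> x) \<le> B"
    using test_funs_bounded[OF test_funs_vderiv_funpow[OF assms]] by metis
  \<comment> \<open>Of the factor 3, the oscillation of the second derivative accounts for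
    \<open>2 * B\<close> and the linear term for \<open>B\<close>. The constant is not meant to be
    sharp.\<close>
  have lip: "norm (vderiv \<theta> b - vderiv \<theta> a) \<le> 3 * B * \<bar>b - a\<bar>" for a b
  proof -
    have 1: "norm (vderiv (vderiv \<theta>) x) \<le> B" for x using B(2)[of x] by (simp add: numeral_2_eq_2)
    have "norm (vderiv \<theta> b - vderiv \<theta> a - (b - a) *\<^sub>R vderiv (vderiv \<theta>) a) \<le> norm (b - a) * (2 * B)"
    proof (rule vector_differentiable_bound_linearization[where S = UNIV])
      show "norm (vderiv (vderiv \<theta>) x - vderiv (vderiv \<theta>) a) \<le> 2 * B" for x
        using norm_triangle_ineq4[of "vderiv (vderiv \<theta>) x" "vderiv (vderiv \<theta>) a"] 1[of x] 1[of a] by simp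
    qed (auto intro!: smooth_has_vderiv smooth_vderiv test_funs_smooth[OF assms])
    moreover have "norm ((b - a) *\<^sub>R vderiv (vderiv \<theta>) a) \<le> \<bar>b - a\<bar> * B"
      using 1[of a] by (simp add: mult_left_mono)
    ultimately show ?thesis
      using norm_triangle_ineq2[of "vderiv \<theta> b - vderiv \<theta> a" "(b - a) *\<^sub>R vderiv (vderiv \<theta>) a"]
      by (simp add: algebra_simps)
  qed
  have "norm (\<theta> b - \<theta> a - (b - a) *\<^sub>R vderiv \<theta> a) \<le> norm (b - a) * (3 * B * \<bar>b - a\<bar>)" for a b
  proof (rule vector_differentiable_bound_linearization[where S = "closed_segment a b"])
    show "norm (vderiv \<theta> x - vderiv \<theta> a) \<le> 3 * B * \<bar>b - a\<bar>" if "x \<in> closed_segment a b" for x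
    proof -
      have "\<bar>x - a\<bar> \<le> \<bar>b - a\<bar>" using that by (auto simp: closed_segment_eq_real_ivl split: if_splits)
      then have "3 * B * \<bar>x - a\<bar> \<le> 3 * B * \<bar>b - a\<bar>" using B(1) by (intro mult_left_mono) auto
      then show ?thesis using lip[of x a] by linarith
    qed
  qed (auto intro!: has_vector_derivative_at_within smooth_has_vderiv test_funs_smooth assms)
  then show ?thesis
    using B(1) by (intro that[of "3 * B"]) (simp_all add: power2_eq_square abs_mult_self_eq mult_ac)
qed


section \<open>Convolution\<close>

lemma pw_cont_shift_mult:
  assumes "pw_cont g" "\<theta> \<in> test_funs"
  shows "pw_cont (\<lambda>y. g y * \<theta> (x - y))"
proof -
  have "isCont (\<lambda>y. \<theta> (x - y)) y" for y
    by (rule isCont_o2[where g = \<theta>]) (auto intro!: continuous_intros test_funs_isCont assms)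
  then show ?thesis by (intro pw_cont_mult[OF assms(1)] pw_cont_isCont)
qed

lemma convolution_integrable:
  assumes "pw_cont g" "\<theta> \<in> test_funs"
  shows "integrable lborel (\<lambda>y. g y * \<theta> (x - y))"
proof -
  obtain R where R: "\<And>x. \<bar>x\<bar> > R \<Longrightarrow> \<theta> x = 0" using assms(2) by (rule test_funs_supportE) blast
  show ?thesis
    by (rule pw_cont_integrable[where R = "R + \<bar>x\<bar>"]) (use assms R in \<open>auto intro!: pw_cont_shift_mult\<close>)
qed

text \<open>The derivative is put on the smooth factor, so nothing beyond piecewise continuity is
  asked of \<open>g\<close>. The uniform quadratic Taylor remainder of \<open>\<theta>\<close> is
  integrated against \<open>g\<close>.\<close>

lemma convolution_has_vector_derivative:
  assumes g: "pw_cont g" and \<theta>: "\<theta> \<in> test_funs"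
  shows "(convolution g \<theta> has_vector_derivative convolution g (vderiv \<theta>) x) (at x)"
proof -
  obtain R where R: "R > 0" "\<And>x. \<bar>x\<bar> > R \<Longrightarrow> \<theta> x = 0" using \<theta> by (rule test_funs_supportE) blast
  have R': "vderiv \<theta> x = 0" if "\<bar>x\<bar> > R" for x
    using vderiv_funpow_eq_0_outside[where k = 1] R that by force
  obtain M where M: "M > 0" "\<And>a b. norm (\<theta> b - \<theta> a - (b - a) *\<^sub>R vderiv \<theta> a) \<le> M * (b - a)\<^sup>2"
    using \<theta> by (rule test_funs_taylor) blast
  \<comment> \<open>For \<open>z\<close> within distance 1 of \<open>x\<close>, both shifted
    supports lie within \<open>R + 1\<close> of \<open>x\<close>. Hence \<open>g\<close> is bounded
    on this range, and the factor \<open>2 * (R + 1)\<close> in \<open>C\<close> is the length of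
    the window of integration.\<close>
  obtain B where B: "B > 0" "\<And>y. \<bar>y\<bar> \<le> \<bar>x\<bar> + R + 1 \<Longrightarrow> norm (g y) \<le> B"
    using pw_cont_bounded[OF g] by metis
  define C where "C = 2 * (R + 1) * (B * M)"
  have bound: "norm (convolution g \<theta> z - convolution g \<theta> x - (z - x) *\<^sub>R convolution g (vderiv \<theta>) x)
      \<le> C * \<bar>z - x\<bar> * \<bar>z - x\<bar>" if z: "dist z x < 1" for z
  proof -
    have "convolution g \<theta> z - convolution g \<theta> x - (z - x) *\<^sub>R convolution g (vderiv \<theta>) x =
        (LINT y|lborel. g y * \<theta> (z - y) - g y * \<theta> (x - y) - (z - x) *\<^sub>R (g y * vderiv \<theta> (x - y)))"
      unfolding convolution_def
      by (simp add: convolution_integrable g \<theta> test_funs_vderiv)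
    also have "\<dots> = (LINT y|lborel. g y * (\<theta> (z - y) - \<theta> (x - y) - (z - x) *\<^sub>R vderiv \<theta> (x - y)))"
      by (simp add: algebra_simps)
    also have "norm \<dots> \<le> 2 * (R + 1) * (B * (M * (z - x)\<^sup>2))"
    proof (rule norm_integral_le[where a = x])
      fix y assume y: "\<bar>y - x\<bar> \<le> R + 1"
      show "norm (g y * (\<theta> (z - y) - \<theta> (x - y) - (z - x) *\<^sub>R vderiv \<theta> (x - y))) \<le> B * (M * (z - x)\<^sup>2)"
        unfolding norm_mult using y B M(2)[of "z - y" "x - y"] by (intro mult_mono) auto
    next
      fix y assume y: "\<bar>y - x\<bar> > R + 1"
      have "\<theta> (z - y) = 0" "\<theta> (x - y) = 0" "vderiv \<theta> (x - y) = 0"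
        using y z by (auto intro!: R R' simp: dist_real_def)
      then show "g y * (\<theta> (z - y) - \<theta> (x - y) - (z - x) *\<^sub>R vderiv \<theta> (x - y)) = 0" by simp
    qed (use R in auto)
    also have "\<dots> = C * \<bar>z - x\<bar> * \<bar>z - x\<bar>" by (simp add: C_def power2_eq_square)
    finally show ?thesis .
  qed
  show ?thesis unfolding has_vector_derivative_def
  proof (rule has_derivativeI_sandwich[where e = 1 and H = "\<lambda>z. C * \<bar>z - x\<bar>"])
    show "((\<lambda>z. C * \<bar>z - x\<bar>) \<longlongrightarrow> 0) (at x)"
      by (rule tendsto_eq_rhs[where x = "C * \<bar>x - x\<bar>"]) (intro tendsto_intros, simp)
  qed (use bound in \<open>auto simp: divide_le_eq bounded_linear_scaleR_left\<close>)
qed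

lemma vderiv_convolution:
  "pw_cont g \<Longrightarrow> \<theta> \<in> test_funs \<Longrightarrow> vderiv (convolution g \<theta>) = convolution g (vderiv \<theta>)"
  by (intro vderiv_eqI convolution_has_vector_derivative)

lemma vderiv_funpow_convolution:
  assumes "pw_cont g" "\<theta> \<in> test_funs"
  shows "(vderiv ^^ k) (convolution g \<theta>) = convolution g ((vderiv ^^ k) \<theta>)"
  by (induction k) (auto simp: vderiv_convolution assms test_funs_vderiv_funpow)

lemma smooth_convolution:
  assumes "pw_cont g" "\<theta> \<in> test_funs"
  shows "smooth (convolution g \<theta>)"
  unfolding smooth_def vderiv_funpow_convolution[OF assms]
  by (metis assms convolution_has_vector_derivative test_funs_vderiv_funpow differentiableI_vector)

text \<open>This is integration by parts for \<open>y\<close> mapped to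
  \<open>g y * \<theta> (x - y)\<close>, which jumps at \<open>0\<close>. In distributional terms,
  the derivative of \<open>g\<close> is its pointwise derivative plus the jump times the Dirac
  distribution, convolved with \<open>\<theta>\<close>.\<close>

lemma convolution_vderiv_jump:
  assumes g: "pw_cont g" and g': "pw_cont g'"
    and deriv: "\<And>x. x \<noteq> 0 \<Longrightarrow> (g has_vector_derivative g' x) (at x)"
    and \<theta>: "\<theta> \<in> test_funs"
  shows "convolution g (vderiv \<theta>) x =
    (Lim (at_right 0) g - Lim (at_left 0) g) * \<theta> x + convolution g' \<theta> x"
proof -
  obtain R where R: "R > 0" "\<And>x. \<bar>x\<bar> > R \<Longrightarrow> \<theta> x = 0" using \<theta> by (rule test_funs_supportE) blast
  have R': "vderiv \<theta> x = 0" if "\<bar>x\<bar> > R" for x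
    using vderiv_funpow_eq_0_outside[where k = 1] R that by force
  have lim: "Lim (at 0 within S) (\<lambda>y. g y * \<theta> (x - y)) = Lim (at 0 within S) g * \<theta> x"
    if "(g \<longlongrightarrow> l) (at 0 within S)" "at 0 within S \<noteq> bot" for l S
  proof -
    have "isCont (\<lambda>y. \<theta> (x - y)) 0"
      by (rule isCont_o2[where g = \<theta>]) (auto intro!: continuous_intros test_funs_isCont \<theta>)
    then have "((\<lambda>y. \<theta> (x - y)) \<longlongrightarrow> \<theta> x) (at 0 within S)"
      by (auto simp: isCont_def intro: tendsto_within_subset)
    then show ?thesis
      using that by (subst tendsto_Lim[OF _ that(1)], simp, intro tendsto_Lim tendsto_mult)
  qed
  obtain l r where lr: "(g \<longlongrightarrow> l) (at_left 0)" "(g \<longlongrightarrow> r) (at_right 0)"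
    using g by (auto simp: pw_cont_def)
  have "(LINT y|lborel. g' y * \<theta> (x - y) - g y * vderiv \<theta> (x - y)) =
      Lim (at_left 0) (\<lambda>y. g y * \<theta> (x - y)) - Lim (at_right 0) (\<lambda>y. g y * \<theta> (x - y))"
  proof (rule integral_deriv_jump[where R = "R + \<bar>x\<bar>"])
    fix y :: real assume "y \<noteq> 0"
    have "((\<lambda>y. x - y) has_real_derivative -1) (at y)"
      by (auto intro!: derivative_eq_intros)
    then have "(\<theta> \<circ> (\<lambda>y. x - y) has_vector_derivative (-1) *\<^sub>R vderiv \<theta> (x - y)) (at y)"
      by (intro vector_diff_chain_at smooth_has_vderiv test_funs_smooth \<theta>)
         (simp add: has_real_derivative_iff_has_vector_derivative)
    then have "((\<lambda>y. \<theta> (x - y)) has_vector_derivative - vderiv \<theta> (x - y)) (at y)"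
      by (simp add: o_def)
    from has_vector_derivative_mult[OF deriv[OF \<open>y \<noteq> 0\<close>] this]
    show "((\<lambda>y. g y * \<theta> (x - y)) has_vector_derivative
        g' y * \<theta> (x - y) - g y * vderiv \<theta> (x - y)) (at y)"
      by (simp add: algebra_simps)
  next
    fix y assume "\<bar>y\<bar> > R + \<bar>x\<bar>"
    then have *: "\<theta> (x - y) = 0" "vderiv \<theta> (x - y) = 0" by (auto intro!: R R')
    then show "g y * \<theta> (x - y) = 0" "g' y * \<theta> (x - y) - g y * vderiv \<theta> (x - y) = 0" by auto
  qed (intro pw_cont_diff pw_cont_shift_mult g g' \<theta> test_funs_vderiv)+
  also have "\<dots> = Lim (at_left 0) g * \<theta> x - Lim (at_right 0) g * \<theta> x"
    by (subst lim[OF lr(1)], simp, subst lim[OF lr(2)], simp_all)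
  finally show ?thesis
    unfolding convolution_def
    by (simp add: convolution_integrable g g' \<theta> test_funs_vderiv algebra_simps)
qed

section \<open>Derivatives of functions in \<open>C_d\<close>\<close>

lemma C_d_has_vector_derivative:
  assumes "f \<in> C_d k" "i < k" "x \<noteq> 0"
  shows "((vderiv ^^ i) f has_vector_derivative (vderiv ^^ Suc i) f x) (at x)"
  using assms vector_derivative_works by (simp add: C_d_def vderiv_def) blast

text \<open>Continuity off \<open>0\<close> is deduced from differentiability, whence the strict
  bound on \<open>i\<close>. For \<open>k = 3\<close> this reaches the second derivative, the
  highest one occurring in the limit.\<close>

lemma C_d_pw_cont:
  assumes "f \<in> C_d k" "i < k"
  shows "pw_cont ((vderiv ^^ i) f)"
  using assms unfolding C_d_def pw_cont_def
  by (auto intro: differentiable_imp_continuous_within)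


section \<open>The product\<close>

text \<open>The integrand on the left differs from the derivative of a test function only by terms
  free of derivatives of \<open>E\<close>. The coefficient 3/2 is \<open>2 - 1/2\<close>: the
  product rule yields the cross term with \<open>vderiv \<psi>\<close> twice, and rewriting
  \<open>E' E\<close> as half the derivative of the square of \<open>E\<close> takes one half
  back.\<close>

lemma integral_model_mult_vderiv2:
  fixes f E \<psi> :: "real \<Rightarrow> complex"
  assumes f: "f \<in> C_d 3" and E: "E \<in> test_funs" and \<psi>: "\<psi> \<in> test_funs"
  shows "(LINT x|lborel. convolution f E x * vderiv (vderiv E) x * \<psi> x) =
    h_coeff f 1 * (LINT x|lborel. (E x)\<^sup>2 * \<psi> x)
    + 3 / 2 * h_coeff f 0 * (LINT x|lborel. (E x)\<^sup>2 * vderiv \<psi> x)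
    + (LINT x|lborel. convolution ((vderiv ^^ 2) f) E x * E x * \<psi> x)
    + 2 * (LINT x|lborel. convolution (vderiv f) E x * E x * vderiv \<psi> x)
    + (LINT x|lborel. convolution f E x * E x * (vderiv ^^ 2) \<psi> x)"
proof -
  define F where "F k = convolution ((vderiv ^^ k) f) E" for k
  define E1 where "E1 = vderiv E"
  define E2 where "E2 = vderiv E1"
  define p1 where "p1 = vderiv \<psi>"
  define p2 where "p2 = vderiv p1"
  define h0 where "h0 = h_coeff f 0"
  define h1 where "h1 = h_coeff f 1"
  have pw: "pw_cont ((vderiv ^^ k) f)" if "k < 3" for k
    using C_d_pw_cont[OF f that] .
  have t: "E1 \<in> test_funs" "E2 \<in> test_funs" "p1 \<in> test_funs" "p2 \<in> test_funs"
    using E \<psi> by (auto simp: E1_def E2_def p1_def p2_def intro!: test_funs_vderiv)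
  \<comment> \<open>The derivative of the convolution is computed with the derivative on
    \<open>E\<close> and then moved to the \<open>k\<close>-th derivative of \<open>f\<close>, which
    releases the jump of order \<open>k\<close>.\<close>
  have F_deriv: "(F k has_vector_derivative h_coeff f k * E x + F (Suc k) x) (at x)" if "k < 2" for k x
    unfolding F_def h_coeff_def
    by (subst convolution_vderiv_jump[symmetric])
       (use that E in \<open>auto intro!: pw C_d_has_vector_derivative[OF f, unfolded funpow.simps o_apply]
            convolution_has_vector_derivative pw[of "Suc _", unfolded funpow.simps o_apply]\<close>)
  have d: "(E has_vector_derivative E1 x) (at x)" "(E1 has_vector_derivative E2 x) (at x)"
    "(\<psi> has_vector_derivative p1 x) (at x)" "(p1 has_vector_derivative p2 x) (at x)" for x
    using E \<psi> t unfolding E1_def E2_def p1_def p2_def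
    by (auto intro!: smooth_has_vderiv test_funs_smooth)
  have F0: "(F 0 has_vector_derivative h0 * E x + F 1 x) (at x)"
    and F1: "(F 1 has_vector_derivative h1 * E x + F 2 x) (at x)" for x
    using F_deriv[of 0 x] F_deriv[of 1 x] by (simp_all add: h0_def h1_def numeral_2_eq_2)
  have smF: "smooth (F k)" if "k < 3" for k
    unfolding F_def by (rule smooth_convolution[OF pw[OF that] E])
  have smooth: "smooth \<psi>" "smooth p1" "smooth p2" "smooth E" "smooth E1" "smooth E2" "smooth (F 0)" "smooth (F 1)" "smooth (F 2)"
    using \<psi> E t by (auto intro: test_funs_smooth smF)
  txt \<open>\<open>V = (f * E) \<psi> E' - ((f * E) \<psi>)' E + h\<^sub>0 E\<^sup>2 \<psi> / 2\<close>, with the jump term of \<open>(f * E)'\<close> made explicit.\<close>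
  define V where "V = (\<lambda>x. F 0 x * E1 x * \<psi> x + (- 1) * ((h0 * E x + F 1 x) * E x * \<psi> x)
     + (- 1) * (F 0 x * E x * p1 x) + (h0 / 2) * (E x * E x * \<psi> x))"
  have V: "V \<in> test_funs"
    unfolding V_def using \<psi> t
    by (intro test_funs_add test_funs_cmult test_funs_mult smooth_mult smooth_add smooth smooth_const)
  have "vderiv V = (\<lambda>x. F 0 x * E2 x * \<psi> x - h1 * ((E x)\<^sup>2 * \<psi> x) - 3 / 2 * h0 * ((E x)\<^sup>2 * p1 x)
     - F 2 x * E x * \<psi> x - 2 * (F 1 x * E x * p1 x) - F 0 x * E x * p2 x)"
  proof (rule vderiv_eqI)
    fix x
    show "(V has_vector_derivative F 0 x * E2 x * \<psi> x - h1 * ((E x)\<^sup>2 * \<psi> x) - 3 / 2 * h0 * ((E x)\<^sup>2 * p1 x)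
     - F 2 x * E x * \<psi> x - 2 * (F 1 x * E x * p1 x) - F 0 x * E x * p2 x) (at x)"
      unfolding V_def
      by (rule derivative_eq_intros F0 F1 d refl)+ (simp add: field_simps power2_eq_square)
  qed
  moreover have int: "integrable lborel (\<lambda>x. g x * \<theta> x)" if "smooth g" "\<theta> \<in> test_funs" for g \<theta>
    using that by (intro test_funs_integrable pw_cont_isCont smooth_isCont)
  have "integrable lborel (\<lambda>x. F 0 x * E2 x * \<psi> x)" "integrable lborel (\<lambda>x. (E x)\<^sup>2 * \<psi> x)"
    "integrable lborel (\<lambda>x. (E x)\<^sup>2 * p1 x)" "integrable lborel (\<lambda>x. F 2 x * E x * \<psi> x)"
    "integrable lborel (\<lambda>x. F 1 x * E x * p1 x)" "integrable lborel (\<lambda>x. F 0 x * E x * p2 x)"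
    unfolding power2_eq_square using \<psi> t by (auto intro!: int smooth_mult smooth smF)
  ultimately have "(LINT x|lborel. vderiv V x) = (LINT x|lborel. F 0 x * E2 x * \<psi> x)
    - h1 * (LINT x|lborel. (E x)\<^sup>2 * \<psi> x) - 3 / 2 * h0 * (LINT x|lborel. (E x)\<^sup>2 * p1 x)
    - (LINT x|lborel. F 2 x * E x * \<psi> x) - 2 * (LINT x|lborel. F 1 x * E x * p1 x)
    - (LINT x|lborel. F 0 x * E x * p2 x)"
    by simp
  then have "(LINT x|lborel. F 0 x * E2 x * \<psi> x) = h1 * (LINT x|lborel. (E x)\<^sup>2 * \<psi> x)
    + 3 / 2 * h0 * (LINT x|lborel. (E x)\<^sup>2 * p1 x)
    + (LINT x|lborel. F 2 x * E x * \<psi> x)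
    + 2 * (LINT x|lborel. F 1 x * E x * p1 x)
    + (LINT x|lborel. F 0 x * E x * p2 x)"
    unfolding integral_vderiv_test_funs[OF V] by (simp only: algebra_simps) (simp add: algebra_simps)
  then show ?thesis
    by (simp add: F_def E1_def E2_def p1_def p2_def h0_def h1_def numeral_2_eq_2)
qed

section \<open>Modelling functions\<close>

lemma lborel_integral_shift_reflect:
  fixes g :: "real \<Rightarrow> 'a::{banach, second_countable_topology}"
  shows "(LINT y|lborel. g (a - y)) = (LINT y|lborel. g y)"
  using lborel_integral_real_affine[of "-1" g a] by simp

lemma lborel_integral_reflect:
  fixes g :: "real \<Rightarrow> 'a::{banach, second_countable_topology}"
  shows "(LINT y|lborel. g (- y)) = (LINT y|lborel. g y)"
  using lborel_integral_shift_reflect[of g 0] by simp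

lemma test_funs_norm_integrable: "\<theta> \<in> test_funs \<Longrightarrow> integrable lborel (\<lambda>x. norm (\<theta> x))"
  using test_funs_integrable[of "\<lambda>x. 1" \<theta>] by (simp add: pw_cont_isCont)

text \<open>The point \<open>y = 0\<close> is exempt as a null set. This matters because the bound
  will be applied to a function that tends to 0 at the origin but whose value at the origin is
  uncontrolled.\<close>

lemma norm_convolution_le:
  assumes g: "pw_cont g" and \<theta>: "\<theta> \<in> test_funs"
    and B: "\<And>y. y \<noteq> 0 \<Longrightarrow> \<theta> (x - y) \<noteq> 0 \<Longrightarrow> norm (g y) \<le> B"
  shows "norm (convolution g \<theta> x) \<le> B * (LINT y|lborel. norm (\<theta> y))"
proof -
  have "norm (convolution g \<theta> x) \<le> (LINT y|lborel. norm (g y * \<theta> (x - y)))"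
    unfolding convolution_def by (rule integral_norm_bound)
  also have "\<dots> \<le> (LINT y|lborel. B * norm (\<theta> (x - y)))"
  proof (rule integral_mono_AE)
    show "integrable lborel (\<lambda>y. norm (g y * \<theta> (x - y)))"
      by (intro integrable_norm convolution_integrable g \<theta>)
    show "integrable lborel (\<lambda>y. B * norm (\<theta> (x - y)))"
      using convolution_integrable[of "\<lambda>x. 1" \<theta> x] \<theta> by (simp add: pw_cont_isCont)
    show "AE y in lborel. norm (g y * \<theta> (x - y)) \<le> B * norm (\<theta> (x - y))"
      using AE_lborel_singleton[of 0]
    proof eventually_elim
      case (elim y)
      then show ?case
        using B[of y] by (cases "\<theta> (x - y) = 0") (auto simp: norm_mult mult_right_mono)
    qed
  qed
  also have "\<dots> = B * (LINT y|lborel. norm (\<theta> y))"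
    using lborel_integral_shift_reflect[of "\<lambda>y. norm (\<theta> y)" x] by simp
  finally show ?thesis .
qed

text \<open>In contrast to \<open>norm_integral_le\<close>, the test function enters through its L1
  norm instead of its maximum. For the modelling functions it is the L1 norm that stays
  bounded.\<close>

lemma norm_integral_mult_le:
  assumes g: "pw_cont g" and \<theta>: "\<theta> \<in> test_funs"
    and B: "\<And>x. \<theta> x \<noteq> 0 \<Longrightarrow> norm (g x) \<le> B"
  shows "norm (LINT x|lborel. g x * \<theta> x) \<le> B * (LINT x|lborel. norm (\<theta> x))"
proof -
  have "norm (LINT x|lborel. g x * \<theta> x) \<le> (LINT x|lborel. B * norm (\<theta> x))"
  proof (rule Bochner_Integration.integral_norm_bound_integral)
    show "norm (g x * \<theta> x) \<le> B * norm (\<theta> x)" for x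
      using B[of x] by (cases "\<theta> x = 0") (auto simp: norm_mult mult_right_mono)
  qed (auto intro!: test_funs_integrable test_funs_norm_integrable g \<theta>)
  then show ?thesis by simp
qed

lemma convolution_const: "convolution (\<lambda>y. c) \<theta> x = c * (LINT y|lborel. \<theta> y)"
  using lborel_integral_shift_reflect[of \<theta> x] by (simp add: convolution_def)

text \<open>Evenness of \<open>\<theta>\<close> transfers a reflection of the argument to
  \<open>g\<close>; this is how \<open>g\<close> gets symmetrised in the limit below.\<close>

lemma convolution_reflect:
  assumes "\<And>x. \<theta> (- x) = \<theta> x"
  shows "convolution g \<theta> (- x) = convolution (\<lambda>y. g (- y)) \<theta> x"
proof -
  have "convolution g \<theta> (- x) = (LINT y|lborel. g (- y) * \<theta> (- x - - y))"
    unfolding convolution_def by (rule lborel_integral_reflect[symmetric])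
  also have "\<dots> = convolution (\<lambda>y. g (- y)) \<theta> x"
    unfolding convolution_def using assms[of "x - _"] by simp
  finally show ?thesis .
qed

lemma tendsto_reflect:
  fixes g :: "real \<Rightarrow> 'a::topological_space"
  shows "((\<lambda>y. g (- y)) \<longlongrightarrow> l) (at_right 0) \<longleftrightarrow> (g \<longlongrightarrow> l) (at_left 0)"
    "((\<lambda>y. g (- y)) \<longlongrightarrow> l) (at_left 0) \<longleftrightarrow> (g \<longlongrightarrow> l) (at_right 0)"
  using filterlim_at_left_to_right[of g "nhds l" 0] filterlim_at_left_to_right[of "\<lambda>y. g (- y)" "nhds l" 0] by simp_all

lemma pw_cont_reflect:
  assumes "pw_cont g"
  shows "pw_cont (\<lambda>y. g (- y))"
proof -
  have "isCont (\<lambda>y. g (- y)) x" if "x \<noteq> 0" for x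
    by (rule isCont_o2[where g = g]) (use that assms in \<open>auto simp: pw_cont_def\<close>)
  moreover have "\<exists>l. ((\<lambda>y. g (- y)) \<longlongrightarrow> l) (at_right 0)" "\<exists>l. ((\<lambda>y. g (- y)) \<longlongrightarrow> l) (at_left 0)"
    using assms by (simp_all only: pw_cont_def tendsto_reflect[of g])
  ultimately show ?thesis by (simp only: pw_cont_def) blast
qed

section \<open>Normalisation and bounds of the scaled modelling function\<close>

lemma D_sigma:
  assumes "delta_modelling D" "\<sigma> > 0"
  shows D_sigma_test_funs: "D_sigma D \<sigma> \<in> test_funs"
    and D_sigma_even: "D_sigma D \<sigma> (- x) = D_sigma D \<sigma> x"
    and D_sigma_integral: "(LINT x|lborel. D_sigma D \<sigma> x) = 1"
    and D_sigma_square_integral: "(LINT x|lborel. (D_sigma D \<sigma> x)\<^sup>2) = 1"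
proof -
  have D: "D \<sigma> \<in> test_funs" "D \<sigma> (- x) = D \<sigma> x" "(LINT x|lborel. (D \<sigma> x)\<^sup>2) = of_real \<sigma>"
    "(LINT x|lborel. D \<sigma> x) = 1" for x
    using assms by (auto simp: delta_modelling_def field_simps)
  obtain R where R: "R > 0" "\<And>x. \<bar>x\<bar> > R \<Longrightarrow> D \<sigma> x = 0" using D(1) by (rule test_funs_supportE) blast
  have "smooth (\<lambda>x. (1 / of_real \<sigma>) * D \<sigma> (x / \<sigma>))"
    using assms(2) D(1) by (intro smooth_affine test_funs_smooth) auto
  moreover have "\<forall>x. \<bar>x\<bar> > R * \<sigma> \<longrightarrow> D_sigma D \<sigma> x = 0"
    using assms(2) R by (auto simp: D_sigma_def field_simps abs_mult intro!: R)
  ultimately show "D_sigma D \<sigma> \<in> test_funs"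
    using R(1) assms(2) unfolding test_funs_iff by (auto simp: D_sigma_def intro!: exI[of _ "R * \<sigma>"])
  show "D_sigma D \<sigma> (- x) = D_sigma D \<sigma> x" using D(2) by (simp add: D_sigma_def)
  \<comment> \<open>Substitution gains one factor \<open>\<sigma>\<close>, while the square of
    \<open>D_sigma\<close> carries two in its denominator. The factor \<open>1 / s\<close> in the
    normalisation of the square of \<open>D\<close> absorbs the one that remains.\<close>
  have scale: "(LINT x|lborel. g (x / \<sigma>)) = of_real \<sigma> * (LINT x|lborel. g x)" for g :: "real \<Rightarrow> complex"
    using lborel_integral_real_affine[of \<sigma> "\<lambda>x. g (x / \<sigma>)" 0] assms(2) by (simp add: scaleR_conv_of_real)
  show "(LINT x|lborel. D_sigma D \<sigma> x) = 1" "(LINT x|lborel. (D_sigma D \<sigma> x)\<^sup>2) = 1"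
    using scale[of "\<lambda>x. D \<sigma> x / of_real \<sigma>"] scale[of "\<lambda>x. (D \<sigma> x / of_real \<sigma>)\<^sup>2"] D assms(2)
    by (simp_all add: D_sigma_def power_divide power2_eq_square)
qed

text \<open>
  The bound for \<open>|D|\<close> comes from \<open>2 |D| \<le> 1 + |D|\<^sup>2\<close> on the support.
\<close>

lemma D_sigma_localized:
  assumes D: "delta_modelling D" and loc: "uniformly_localized D"
  obtains l C where "l > 0" "C > 0"
    "\<forall>\<^sub>F \<sigma> in at_right 0. (\<forall>x. \<bar>x\<bar> > l * \<sigma> \<longrightarrow> D_sigma D \<sigma> x = 0) \<and>
       \<sigma> * (LINT x|lborel. (norm (D_sigma D \<sigma> x))\<^sup>2) \<le> C \<and> (LINT x|lborel. norm (D_sigma D \<sigma> x)) \<le> C"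
proof -
  obtain l0 C0 where lC: "\<forall>\<^sub>F s in at_right 0.
     (\<forall>x. \<bar>x\<bar> > l0 \<longrightarrow> D s x = 0) \<and> (LINT x|lborel. (norm (D s x))\<^sup>2) \<le> C0"
    using loc by (auto simp: uniformly_localized_def)
  define l where "l = max l0 1"
  \<comment> \<open>The summand \<open>2 * l\<close> is the length of the interval containing the
    support, and comes from integrating the constant 1 over it.\<close>
  define C where "C = 2 * l + \<bar>C0\<bar>"
  have l: "l > 0" by (simp add: l_def)
  have "\<forall>\<^sub>F \<sigma> in at_right 0. (\<forall>x. \<bar>x\<bar> > l * \<sigma> \<longrightarrow> D_sigma D \<sigma> x = 0) \<and>
       \<sigma> * (LINT x|lborel. (norm (D_sigma D \<sigma> x))\<^sup>2) \<le> C \<and> (LINT x|lborel. norm (D_sigma D \<sigma> x)) \<le> C"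
    using lC eventually_at_right_less[of 0]
  proof eventually_elim
    case (elim \<sigma>)
    have supp: "D \<sigma> x = 0" if "\<bar>x\<bar> > l" for x using elim that by (simp add: l_def)
    have D\<sigma>: "D \<sigma> \<in> test_funs" using D elim by (simp add: delta_modelling_def)
    have int2: "integrable lborel (\<lambda>x. (norm (D \<sigma> x))\<^sup>2)"
      using integrable_norm[OF test_funs_integrable[of "D \<sigma>" "D \<sigma>"]] D\<sigma>
      by (simp add: pw_cont_isCont test_funs_isCont norm_mult power2_eq_square)
    have "(LINT x|lborel. norm (D \<sigma> x)) \<le> (LINT x|lborel. indicator {-l..l} x + (norm (D \<sigma> x))\<^sup>2)"
    proof (rule integral_mono)
      show "integrable lborel (\<lambda>x. indicator {-l..l} x + (norm (D \<sigma> x))\<^sup>2)"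
        by (intro Bochner_Integration.integrable_add int2 integrable_real_indicator) (auto simp: emeasure_lborel_Icc_eq)
      fix x
      show "norm (D \<sigma> x) \<le> indicator {-l..l} x + (norm (D \<sigma> x))\<^sup>2"
      proof (cases "\<bar>x\<bar> > l")
        case False
        have "2 * norm (D \<sigma> x) \<le> 1 + (norm (D \<sigma> x))\<^sup>2"
          using zero_le_power2[of "norm (D \<sigma> x) - 1"] by (simp add: power2_diff)
        then have "norm (D \<sigma> x) \<le> 1 + (norm (D \<sigma> x))\<^sup>2" using norm_ge_zero[of "D \<sigma> x"] by linarith
        with False show ?thesis by (auto simp: indicator_def abs_le_iff)
      qed (simp add: supp)
    qed (intro test_funs_norm_integrable D\<sigma>)
    also have "\<dots> = 2 * l + (LINT x|lborel. (norm (D \<sigma> x))\<^sup>2)"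
      using l int2 by (subst Bochner_Integration.integral_add) (auto simp: emeasure_lborel_Icc_eq intro!: integrable_real_indicator)
    also have "\<dots> \<le> C" using elim unfolding C_def by linarith
    finally have 1: "(LINT x|lborel. norm (D \<sigma> x)) \<le> C" .
    have scale: "(LINT x|lborel. g (x / \<sigma>)) = \<sigma> * (LINT x|lborel. g x)" for g :: "real \<Rightarrow> real"
      using lborel_integral_real_affine[of \<sigma> "\<lambda>x. g (x / \<sigma>)" 0] elim by simp
    \<comment> \<open>The L1 norm is invariant under the scaling, whereas the integral of the
      squared norm grows by \<open>1 / \<sigma>\<close>; this explains the factor
      \<open>\<sigma>\<close> in the second bound.\<close>
    have "(LINT x|lborel. norm (D_sigma D \<sigma> x)) = (LINT x|lborel. norm (D \<sigma> x))"
      using scale[of "\<lambda>x. norm (D \<sigma> x) / \<sigma>"] elim by (simp add: D_sigma_def norm_divide)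
    moreover have "\<sigma> * (LINT x|lborel. (norm (D_sigma D \<sigma> x))\<^sup>2) = (LINT x|lborel. (norm (D \<sigma> x))\<^sup>2)"
      using scale[of "\<lambda>x. (norm (D \<sigma> x) / \<sigma>)\<^sup>2"] elim
      by (simp add: D_sigma_def norm_divide power_divide power2_eq_square)
    moreover have "D_sigma D \<sigma> x = 0" if "\<bar>x\<bar> > l * \<sigma>" for x
      using that elim by (simp add: D_sigma_def field_simps supp)
    moreover have "(LINT x|lborel. (norm (D \<sigma> x))\<^sup>2) \<le> C" using elim l unfolding C_def by linarith
    ultimately show ?case using 1 by auto
  qed
  moreover have "C > 0" using l by (simp add: C_def)
  ultimately show ?thesis using that l by blast
qed

section \<open>Limits as the scale tends to 0\<close>

lemma eventually_scaled_less:
  fixes l d :: real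
  assumes "d > 0"
  shows "\<forall>\<^sub>F \<sigma> in at_right 0. l * \<sigma> < d"
proof -
  have "((\<lambda>\<sigma>. l * \<sigma>) \<longlongrightarrow> l * 0) (at_right 0)" by (intro tendsto_intros)
  then show ?thesis using order_tendstoD(2)[of "\<lambda>\<sigma>. l * \<sigma>" 0 "at_right 0" d] assms by simp
qed

lemma tendsto_le_multI:
  fixes I :: "'a \<Rightarrow> 'b::real_normed_vector"
  assumes "\<And>e. e > 0 \<Longrightarrow> \<forall>\<^sub>F \<sigma> in F. norm (I \<sigma> - L) \<le> K * e"
  shows "(I \<longlongrightarrow> L) F"
proof (rule tendstoI)
  fix e :: real assume e: "e > 0"
  \<comment> \<open>\<open>K\<close> may have either sign or vanish, so the tolerance is divided by
    \<open>\<bar>K\<bar> + 1\<close>.\<close>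
  have "K * (e / (\<bar>K\<bar> + 1)) \<le> \<bar>K\<bar> * (e / (\<bar>K\<bar> + 1))" using e by (intro mult_right_mono) auto
  also have "\<dots> < e" using e by (simp add: field_simps)
  finally have *: "K * (e / (\<bar>K\<bar> + 1)) < e" .
  have "\<forall>\<^sub>F \<sigma> in F. norm (I \<sigma> - L) \<le> K * (e / (\<bar>K\<bar> + 1))" using e by (intro assms) simp
  then show "\<forall>\<^sub>F \<sigma> in F. dist (I \<sigma>) L < e"
    by eventually_elim (use * in \<open>auto simp: dist_norm\<close>)
qed

text \<open>The values are complex, and the bound available for the integral of the squared norm of
  \<open>D_sigma\<close> is of order \<open>1 / \<sigma>\<close>, so continuity of the test function
  is too weak. It is expanded to first order instead: the constant term gives the limit, the linear
  term vanishes by evenness, and the remainder is \<open>o(\<sigma>)\<close> on the support.\<close>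

lemma D_sigma_square_tendsto:
  assumes D: "delta_modelling D" "uniformly_localized D" and \<xi>: "\<xi> \<in> test_funs"
  shows "((\<lambda>\<sigma>. LINT x|lborel. (D_sigma D \<sigma> x)\<^sup>2 * \<xi> x) \<longlongrightarrow> \<xi> 0) (at_right 0)"
proof -
  obtain l C where lC: "l > 0" "C > 0"
    and ev: "\<forall>\<^sub>F \<sigma> in at_right 0. (\<forall>x. \<bar>x\<bar> > l * \<sigma> \<longrightarrow> D_sigma D \<sigma> x = 0) \<and>
       \<sigma> * (LINT x|lborel. (norm (D_sigma D \<sigma> x))\<^sup>2) \<le> C \<and> (LINT x|lborel. norm (D_sigma D \<sigma> x)) \<le> C"
    by (rule D_sigma_localized[OF D]) (rule that)
  define \<eta> where "\<eta> = (\<lambda>x. \<xi> x - \<xi> 0 - x *\<^sub>R vderiv \<xi> 0)"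
  have \<eta>: "isCont \<eta> x" for x
    unfolding \<eta>_def by (auto intro!: continuous_intros test_funs_isCont[OF \<xi>])
  show ?thesis
  proof (rule tendsto_le_multI[where K = "l * C"])
    fix e :: real assume e: "e > 0"
    have "(\<xi> has_derivative (\<lambda>h. h *\<^sub>R vderiv \<xi> 0)) (at 0)"
      using smooth_has_vderiv[OF test_funs_smooth[OF \<xi>], of 0] by (simp add: has_vector_derivative_def)
    then have "\<exists>d>0. \<forall>x. norm (x - 0) < d \<longrightarrow> norm (\<xi> x - \<xi> 0 - (x - 0) *\<^sub>R vderiv \<xi> 0) \<le> e * norm (x - 0)"
      using e unfolding has_derivative_at_alt by blast
    then obtain d where d: "d > 0" "\<And>x. \<bar>x\<bar> < d \<Longrightarrow> norm (\<eta> x) \<le> e * \<bar>x\<bar>"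
      by (auto simp: \<eta>_def)
    show "\<forall>\<^sub>F \<sigma> in at_right 0. norm ((LINT x|lborel. (D_sigma D \<sigma> x)\<^sup>2 * \<xi> x) - \<xi> 0) \<le> l * C * e"
      using ev eventually_scaled_less[OF d(1), of l] eventually_at_right_less[of 0]
    proof eventually_elim
      case (elim \<sigma>)
      define E where "E = D_sigma D \<sigma>"
      have E: "E \<in> test_funs" "\<And>x. E (- x) = E x" "(LINT x|lborel. (E x)\<^sup>2) = 1"
        using D_sigma[OF D(1)] elim by (simp_all add: E_def)
      have EE: "(\<lambda>x. E x * E x) \<in> test_funs" using E by (intro test_funs_mult test_funs_smooth)
      have int: "integrable lborel (\<lambda>x. (E x)\<^sup>2 * h x)" if "\<And>x. isCont h x" for h
        using test_funs_integrable[OF pw_cont_isCont EE, of h] that by (simp add: power2_eq_square mult_ac)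
      have "(LINT x|lborel. (E x)\<^sup>2 * of_real x) = (LINT x|lborel. (E (- x))\<^sup>2 * of_real (- x))"
        by (rule lborel_integral_reflect[symmetric])
      also have "\<dots> = - (LINT x|lborel. (E x)\<^sup>2 * of_real x)" by (simp add: E)
      finally have odd: "(LINT x|lborel. (E x)\<^sup>2 * of_real x) = 0" by (simp add: eq_neg_iff_add_eq_0)
      have "(LINT x|lborel. (E x)\<^sup>2 * \<xi> x) =
          (LINT x|lborel. (E x)\<^sup>2 * \<eta> x + \<xi> 0 * (E x)\<^sup>2 + vderiv \<xi> 0 * ((E x)\<^sup>2 * of_real x))"
        by (simp add: \<eta>_def algebra_simps scaleR_conv_of_real)
      also have "\<dots> = (LINT x|lborel. (E x)\<^sup>2 * \<eta> x) + \<xi> 0"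
        using int[OF \<eta>] int[of of_real] int[of "\<lambda>x. 1"] E(3) odd by simp
      finally have "norm ((LINT x|lborel. (E x)\<^sup>2 * \<xi> x) - \<xi> 0) = norm (LINT x|lborel. \<eta> x * (E x * E x))"
        by (simp add: power2_eq_square mult_ac)
      \<comment> \<open>On the support the remainder is at most \<open>e * (l * \<sigma>)\<close>;
        the factor \<open>\<sigma>\<close> is then spent on the integral of the squared
        norm.\<close>
      also have "\<dots> \<le> (e * (l * \<sigma>)) * (LINT x|lborel. norm (E x * E x))"
      proof (rule norm_integral_mult_le[OF _ EE])
        show "pw_cont \<eta>" by (rule pw_cont_isCont[OF \<eta>])
        fix x assume "E x * E x \<noteq> 0"
        then have x: "\<bar>x\<bar> \<le> l * \<sigma>" using elim by (auto simp: E_def not_less[symmetric])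
        then have "norm (\<eta> x) \<le> e * \<bar>x\<bar>" using d(2)[of x] elim by simp
        also have "\<dots> \<le> e * (l * \<sigma>)" using x e by (intro mult_left_mono) auto
        finally show "norm (\<eta> x) \<le> e * (l * \<sigma>)" .
      qed
      also have "\<dots> = e * l * (\<sigma> * (LINT x|lborel. (norm (E x))\<^sup>2))"
        by (simp add: norm_mult power2_eq_square)
      also have "\<dots> \<le> e * l * C" using elim e lC by (intro mult_left_mono) (auto simp: E_def)
      finally show ?case by (simp add: E_def mult_ac)
    qed
  qed
qed

text \<open>Replacing the test function by its value at \<open>0\<close> costs little, since both
  the convolution on the support and the L1 norm of \<open>D_sigma\<close> are bounded. For the
  remaining integral, reflection permits \<open>g\<close> to be averaged with its mirror image, and
  the average is close to the mean of the one-sided limits.\<close>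

lemma convolution_D_sigma_tendsto:
  assumes D: "delta_modelling D" "uniformly_localized D" and g: "pw_cont g" and \<xi>: "\<xi> \<in> test_funs"
  shows "((\<lambda>\<sigma>. LINT x|lborel. convolution g (D_sigma D \<sigma>) x * D_sigma D \<sigma> x * \<xi> x)
    \<longlongrightarrow> 1 / 2 * (Lim (at_right 0) g + Lim (at_left 0) g) * \<xi> 0) (at_right 0)"
proof -
  obtain l C where lC: "l > 0" "C > 0"
    and ev: "\<forall>\<^sub>F \<sigma> in at_right 0. (\<forall>x. \<bar>x\<bar> > l * \<sigma> \<longrightarrow> D_sigma D \<sigma> x = 0) \<and>
       \<sigma> * (LINT x|lborel. (norm (D_sigma D \<sigma> x))\<^sup>2) \<le> C \<and> (LINT x|lborel. norm (D_sigma D \<sigma> x)) \<le> C"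
    by (rule D_sigma_localized[OF D]) (rule that)
  obtain r s where rs: "(g \<longlongrightarrow> r) (at_right 0)" "(g \<longlongrightarrow> s) (at_left 0)"
    using g by (auto simp: pw_cont_def)
  have Lim_g: "Lim (at_right 0) g = r" "Lim (at_left 0) g = s"
    using rs by (auto intro!: tendsto_Lim)
  obtain B where B: "B > 0" "\<And>y. \<bar>y\<bar> \<le> 1 \<Longrightarrow> norm (g y) \<le> B" using pw_cont_bounded[OF g] by metis
  \<comment> \<open>\<open>k\<close> is twice the deviation of the even part of \<open>g\<close>
    from the mean of its one-sided limits. It tends to 0 from both sides, although its value at
    \<open>0\<close> itself may be anything.\<close>
  define k where "k = (\<lambda>y. g y + g (- y) - (r + s))"
  have k: "pw_cont k" unfolding k_def
    by (intro pw_cont_diff pw_cont_add pw_cont_reflect[OF g] g pw_cont_isCont[of "\<lambda>_. r + s"]) auto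
  have "(k \<longlongrightarrow> 0) (at_right 0)" "(k \<longlongrightarrow> 0) (at_left 0)"
    unfolding k_def by (rule tendsto_eq_intros rs rs[folded tendsto_reflect[of g]] refl | simp)+
  then have k0: "(k \<longlongrightarrow> 0) (at 0)" by (simp add: filterlim_split_at)
  have \<xi>_pw: "pw_cont (\<lambda>x. \<xi> x - \<xi> 0)"
    by (intro pw_cont_isCont continuous_intros test_funs_isCont[OF \<xi>])
  show ?thesis
  proof (rule tendsto_le_multI[where K = "B * C * C + norm (\<xi> 0) * (C * C / 2)"])
    fix e :: real assume e: "e > 0"
    have "\<forall>\<^sub>F y in at 0. dist (k y) 0 < e" using k0 e by (rule tendstoD)
    then obtain d where d: "d > 0" "\<And>y. \<bar>y\<bar> < d \<Longrightarrow> y \<noteq> 0 \<Longrightarrow> norm (k y) \<le> e"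
      unfolding eventually_at by (auto intro: less_imp_le)
    have "\<forall>\<^sub>F x in at 0. dist (\<xi> x) (\<xi> 0) < e"
      using test_funs_isCont[OF \<xi>, of 0] e by (auto simp: isCont_def intro: tendstoD)
    then obtain c where c0: "c > 0" "\<And>x. x \<noteq> 0 \<Longrightarrow> \<bar>x\<bar> < c \<Longrightarrow> dist (\<xi> x) (\<xi> 0) < e"
      unfolding eventually_at by auto
    have c: "norm (\<xi> x - \<xi> 0) \<le> e" if "\<bar>x\<bar> < c" for x
      using c0(2)[of x] that e by (cases "x = 0") (auto simp: dist_norm)
    show "\<forall>\<^sub>F \<sigma> in at_right 0. norm ((LINT x|lborel. convolution g (D_sigma D \<sigma>) x * D_sigma D \<sigma> x * \<xi> x)
        - 1 / 2 * (Lim (at_right 0) g + Lim (at_left 0) g) * \<xi> 0) \<le> (B * C * C + norm (\<xi> 0) * (C * C / 2)) * e"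
      \<comment> \<open>The scale \<open>2 * l * \<sigma>\<close> bounds the arguments of
        \<open>g\<close> and \<open>k\<close> in the convolution and must stay below
        \<open>d\<close> and below 1, the range of the bound \<open>B\<close>. The scale
        \<open>l * \<sigma>\<close> bounds the argument of the test function.\<close>
      using ev eventually_scaled_less[OF d(1), of "2 * l"] eventually_scaled_less[OF c0(1), of l]
        eventually_scaled_less[of 1 "2 * l", OF zero_less_one] eventually_at_right_less[of 0]
    proof eventually_elim
      case (elim \<sigma>)
      define E where "E = D_sigma D \<sigma>"
      define J where "J = (LINT x|lborel. norm (E x))"
      have E: "E \<in> test_funs" "\<And>x. E (- x) = E x" "(LINT x|lborel. E x) = 1"
        using D_sigma[OF D(1)] elim by (simp_all add: E_def)
      have supp: "\<bar>x\<bar> \<le> l * \<sigma>" if "E x \<noteq> 0" for x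
        using that elim by (auto simp: E_def not_less[symmetric])
      have J: "0 \<le> J" "J \<le> C" using elim by (auto simp: J_def E_def)
      \<comment> \<open>If \<open>E x\<close> and \<open>E (x - y)\<close> are both nonzero, then
        \<open>y\<close> is within \<open>2 * l * \<sigma>\<close> of the origin, so the convolution
        only sees \<open>h\<close> there.\<close>
      have conv: "norm (convolution h E x) \<le> b * C"
        if "pw_cont h" "E x \<noteq> 0" "b \<ge> 0" "\<And>y. y \<noteq> 0 \<Longrightarrow> \<bar>y\<bar> \<le> 2 * l * \<sigma> \<Longrightarrow> norm (h y) \<le> b" for h x b
      proof -
        have "norm (convolution h E x) \<le> b * J"
          unfolding J_def
        proof (rule norm_convolution_le[OF that(1) E(1)])
          fix y assume "y \<noteq> 0" "E (x - y) \<noteq> 0"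
          then show "norm (h y) \<le> b" using supp[of "x - y"] supp[of x] that by (intro that(4)) auto
        qed
        also have "\<dots> \<le> b * C" using J that by (intro mult_left_mono)
        finally show ?thesis .
      qed
      have sm: "smooth (convolution h E)" if "pw_cont h" for h
        by (rule smooth_convolution[OF that E(1)])
      have pw: "pw_cont (convolution h E)" if "pw_cont h" for h
        by (intro pw_cont_isCont smooth_isCont sm that)
      have int: "integrable lborel (\<lambda>x. convolution h E x * E x)" if "pw_cont h" for h
        by (intro test_funs_integrable pw that E)
      define I where "I = (LINT x|lborel. convolution g E x * E x)"
      \<comment> \<open>Reflecting the outer variable shows that \<open>g\<close> and its mirror
        image give the same integral \<open>I\<close>. Their sum, less the constant
        \<open>r + s\<close>, is the integral formed with \<open>k\<close>.\<close>
      have "I = (LINT x|lborel. convolution g E (- x) * E (- x))"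
        unfolding I_def by (rule lborel_integral_reflect[symmetric])
      also have "\<dots> = (LINT x|lborel. convolution (\<lambda>y. g (- y)) E x * E x)"
        using E by (simp add: convolution_reflect)
      finally have I2: "I = (LINT x|lborel. convolution (\<lambda>y. g (- y)) E x * E x)" .
      have keq: "convolution k E x = convolution g E x + convolution (\<lambda>y. g (- y)) E x - (r + s)" for x
      proof -
        have "convolution k E x = (LINT y|lborel. g y * E (x - y) + g (- y) * E (x - y) - (r + s) * E (x - y))"
          unfolding convolution_def k_def by (simp add: algebra_simps)
        also have "\<dots> = convolution g E x + convolution (\<lambda>y. g (- y)) E x - convolution (\<lambda>y. r + s) E x"
          unfolding convolution_def
          using convolution_integrable[OF g E(1)] convolution_integrable[OF pw_cont_reflect[OF g] E(1)]
            convolution_integrable[OF pw_cont_isCont E(1), of "\<lambda>_. r + s"]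
          by simp
        finally show ?thesis using E by (simp add: convolution_const)
      qed
      have "(LINT x|lborel. convolution k E x * E x) =
         (LINT x|lborel. convolution g E x * E x + convolution (\<lambda>y. g (- y)) E x * E x - (r + s) * E x)"
        unfolding keq by (simp add: algebra_simps)
      also have "\<dots> = I + I - (r + s)"
        using int[OF g] int[OF pw_cont_reflect[OF g]] test_funs_integrable[of "\<lambda>_. r + s" E] E(1,3)
        by (simp add: I_def[symmetric] I2[symmetric] pw_cont_isCont)
      finally have kI: "(LINT x|lborel. convolution k E x * E x) = I + I - (r + s)" .
      have half: "I - 1 / 2 * (r + s) = 1 / 2 * (LINT x|lborel. convolution k E x * E x)"
        unfolding kI by (simp add: field_simps)
      have "norm (LINT x|lborel. convolution k E x * E x) \<le> e * C * J"
        unfolding J_def using e elim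
        by (intro norm_integral_mult_le pw k E conv) (auto intro!: d(2))
      then have I: "norm (I - 1 / 2 * (r + s)) \<le> e * C * J / 2"
        unfolding half norm_mult by simp
      have "(LINT x|lborel. convolution g E x * E x * \<xi> x) =
         (LINT x|lborel. (convolution g E x * (\<xi> x - \<xi> 0)) * E x + \<xi> 0 * (convolution g E x * E x))"
        by (simp add: algebra_simps)
      also have "\<dots> = (LINT x|lborel. (convolution g E x * (\<xi> x - \<xi> 0)) * E x) + \<xi> 0 * I"
        using test_funs_integrable[OF pw_cont_mult[OF pw[OF g] \<xi>_pw] E(1)] int[OF g]
        by (simp add: I_def)
      finally have eq: "(LINT x|lborel. convolution g E x * E x * \<xi> x) - 1 / 2 * (r + s) * \<xi> 0 =
         (LINT x|lborel. (convolution g E x * (\<xi> x - \<xi> 0)) * E x) + \<xi> 0 * (I - 1 / 2 * (r + s))"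
        by (simp add: algebra_simps)
      have "norm (LINT x|lborel. (convolution g E x * (\<xi> x - \<xi> 0)) * E x) \<le> (B * C * e) * J"
        unfolding J_def
      proof (rule norm_integral_mult_le)
        fix x assume x: "E x \<noteq> 0"
        have "norm (convolution g E x) \<le> B * C"
          using elim B x by (intro conv g) auto
        moreover have "norm (\<xi> x - \<xi> 0) \<le> e" using supp[OF x] elim by (intro c) auto
        ultimately show "norm (convolution g E x * (\<xi> x - \<xi> 0)) \<le> B * C * e"
          unfolding norm_mult using B lC by (intro mult_mono) auto
      qed (intro pw_cont_mult pw g E \<xi>_pw)+
      also have "\<dots> \<le> (B * C * e) * C" using J B lC e by (intro mult_left_mono) auto
      finally have 1: "norm (LINT x|lborel. (convolution g E x * (\<xi> x - \<xi> 0)) * E x) \<le> (B * C * e) * C" .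
      have "e * C * J / 2 \<le> e * C * C / 2" using J lC e by (simp add: mult_left_mono)
      with I have "norm (\<xi> 0 * (I - 1 / 2 * (r + s))) \<le> norm (\<xi> 0) * (e * C * C / 2)"
        unfolding norm_mult by (intro mult_left_mono) auto
      with 1 have "norm ((LINT x|lborel. (convolution g E x * (\<xi> x - \<xi> 0)) * E x) + \<xi> 0 * (I - 1 / 2 * (r + s)))
          \<le> (B * C * e) * C + norm (\<xi> 0) * (e * C * C / 2)"
        by (rule norm_triangle_mono)
      then show ?case
        unfolding Lim_g eq[unfolded E_def, symmetric] E_def by (simp add: eq[unfolded E_def] algebra_simps E_def)
    qed
  qed
qed

section \<open>Association of the product\<close>

lemma supp_radius:
  assumes "\<phi> \<in> A_test 0"
  shows supp_radius_pos: "supp_radius \<phi> > 0"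
    and supp_radius_scaled: "\<epsilon> > 0 \<Longrightarrow> supp_radius (scaled \<epsilon> \<phi>) = \<epsilon> * supp_radius \<phi>"
proof -
  let ?S = "{x. \<phi> x \<noteq> 0}"
  have \<phi>: "\<phi> \<in> test_funs" "(LINT x|lborel. \<phi> x) = 1" using assms by (simp_all add: A_test_def)
  obtain R where R: "R > 0" "\<And>x. \<bar>x\<bar> > R \<Longrightarrow> \<phi> x = 0" using \<phi>(1) by (rule test_funs_supportE) blast
  have bdd: "bdd_above (abs ` ?S)"
    using R by (intro bdd_aboveI[of _ R]) (force simp: not_less[symmetric])
  \<comment> \<open>A function supported at the origin alone vanishes almost everywhere and cannot
    have integral 1.\<close>
  have "\<exists>x. x \<noteq> 0 \<and> \<phi> x \<noteq> 0"
  proof (rule ccontr)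
    assume *: "\<not> ?thesis"
    have "AE x in lborel. \<phi> x = 0"
      using AE_lborel_singleton[of 0] by eventually_elim (use * in auto)
    then have "(LINT x|lborel. \<phi> x) = 0" by (rule integral_eq_zero_AE)
    with \<phi> show False by simp
  qed
  then obtain x where x: "x \<noteq> 0" "\<phi> x \<noteq> 0" by blast
  then have "\<bar>x\<bar> \<le> supp_radius \<phi>"
    unfolding supp_radius_def by (intro cSUP_upper bdd) auto
  with x show "supp_radius \<phi> > 0" by linarith
  show "supp_radius (scaled \<epsilon> \<phi>) = \<epsilon> * supp_radius \<phi>" if "\<epsilon> > 0"
  proof -
    have "{x. scaled \<epsilon> \<phi> x \<noteq> 0} = (*) \<epsilon> ` ?S"
    proof (intro equalityI subsetI)
      fix x assume "x \<in> {x. scaled \<epsilon> \<phi> x \<noteq> 0}"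
      then show "x \<in> (*) \<epsilon> ` ?S"
        using that by (intro image_eqI[of _ _ "x / \<epsilon>"]) (auto simp: scaled_def)
    qed (use that in \<open>auto simp: scaled_def\<close>)
    then have "supp_radius (scaled \<epsilon> \<phi>) = (SUP x\<in>?S. \<epsilon> * \<bar>x\<bar>)"
      using that by (simp add: supp_radius_def image_image abs_mult)
    also have "\<dots> = \<epsilon> * supp_radius \<phi>"
      unfolding supp_radius_def
    proof (rule antisym)
      show "(SUP x\<in>?S. \<epsilon> * \<bar>x\<bar>) \<le> \<epsilon> * (SUP x\<in>?S. \<bar>x\<bar>)"
        using that x by (intro cSUP_least mult_left_mono cSUP_upper bdd) auto
      have bdd': "bdd_above ((\<lambda>x. \<epsilon> * \<bar>x\<bar>) ` ?S)"
        using bdd_above_image_mono[of "(*) \<epsilon>" "abs ` ?S"] bdd that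
        by (simp add: image_image mono_def)
      have "(SUP x\<in>?S. \<bar>x\<bar>) \<le> (SUP x\<in>?S. \<epsilon> * \<bar>x\<bar>) / \<epsilon>"
      proof (rule cSUP_least)
        fix y assume "y \<in> ?S"
        then have "\<epsilon> * \<bar>y\<bar> \<le> (SUP x\<in>?S. \<epsilon> * \<bar>x\<bar>)" by (intro cSUP_upper bdd')
        then show "\<bar>y\<bar> \<le> (SUP x\<in>?S. \<epsilon> * \<bar>x\<bar>) / \<epsilon>" using that by (simp add: field_simps)
      qed (use x in auto)
      then show "\<epsilon> * (SUP x\<in>?S. \<bar>x\<bar>) \<le> (SUP x\<in>?S. \<epsilon> * \<bar>x\<bar>)"
        using that by (simp add: field_simps)
    qed
    finally show ?thesis .
  qed
qed

text \<open>The limits above are taken in \<open>\<sigma>\<close>, association in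
  \<open>\<epsilon>\<close>; composing with this filter limit translates one into the other.
  Positivity of the radius keeps the approach one-sided.\<close>

lemma filterlim_supp_radius_scaled:
  assumes "\<phi> \<in> A_test 0"
  shows "filterlim (\<lambda>\<epsilon>. supp_radius (scaled \<epsilon> \<phi>)) (at_right 0) (at_right 0)"
proof -
  have s: "supp_radius \<phi> > 0" by (rule supp_radius_pos[OF assms])
  have "((\<lambda>\<epsilon>. \<epsilon> * supp_radius \<phi>) \<longlongrightarrow> 0 * supp_radius \<phi>) (at_right 0)" by (intro tendsto_intros)
  moreover have "\<forall>\<^sub>F \<epsilon> in at_right 0. \<epsilon> * supp_radius \<phi> > 0"
    using eventually_at_right_less[of 0] by eventually_elim (use s in simp)
  ultimately have "filterlim (\<lambda>\<epsilon>. \<epsilon> * supp_radius \<phi>) (at_right 0) (at_right 0)"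
    by (intro tendsto_imp_filterlim_at_right) simp_all
  moreover have "\<forall>\<^sub>F \<epsilon> in at_right 0. \<epsilon> * supp_radius \<phi> = supp_radius (scaled \<epsilon> \<phi>)"
    using eventually_at_right_less[of 0] by eventually_elim (simp add: supp_radius_scaled[OF assms])
  ultimately show ?thesis by (simp cong: filterlim_cong)
qed

text \<open>All derivatives fall on \<open>D_sigma\<close>, whose support eventually lies in the
  unit interval around 0. Its moderate growth there passes to the convolution with the same
  exponent, times the window length 2 and a bound of \<open>f\<close> on the 1-neighbourhood of
  \<open>K\<close>.\<close>

lemma model_rep_E_M:
  assumes f: "pw_cont f" and D: "delta_modelling D" "uniformly_localized D" "delta_rep D \<in> E_M"
  shows "model_rep D f \<in> E_M"
proof -
  have basic: "model_rep D f \<in> E_basic"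
    unfolding E_basic_def model_rep_def
    by (auto intro!: smooth_convolution f D_sigma_test_funs D supp_radius_pos)
  have "\<exists>q. \<forall>\<phi>\<in>A_test q. sup_deriv (model_rep D f) K p \<phi> \<in> O[at_right 0](\<lambda>\<epsilon>. 1 / \<epsilon> ^ q)"
    if K: "compact K" "K \<noteq> {}" for K p
  proof -
    have I: "compact {-1..1::real}" "{-1..1::real} \<noteq> {}" by auto
    obtain q where q: "\<And>\<phi>. \<phi> \<in> A_test q \<Longrightarrow>
        sup_deriv (delta_rep D) {-1..1} p \<phi> \<in> O[at_right 0](\<lambda>\<epsilon>. 1 / \<epsilon> ^ q)"
      using D(3) I unfolding E_M_def mem_Collect_eq by meson
    obtain R where R: "\<And>x. x \<in> K \<Longrightarrow> \<bar>x\<bar> \<le> R"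
      using compact_imp_bounded[OF K(1)] by (auto simp: bounded_iff)
    obtain B where B: "B > 0" "\<And>y. \<bar>y\<bar> \<le> R + 1 \<Longrightarrow> norm (f y) \<le> B" using pw_cont_bounded[OF f] by metis
    obtain l C where "l > 0" "C > 0"
      and ev: "\<forall>\<^sub>F \<sigma> in at_right 0. (\<forall>x. \<bar>x\<bar> > l * \<sigma> \<longrightarrow> D_sigma D \<sigma> x = 0) \<and>
        \<sigma> * (LINT x|lborel. (norm (D_sigma D \<sigma> x))\<^sup>2) \<le> C \<and> (LINT x|lborel. norm (D_sigma D \<sigma> x)) \<le> C"
      by (rule D_sigma_localized[OF D(1,2)]) (rule that)
    have supp: "\<forall>\<^sub>F \<sigma> in at_right 0. \<forall>x. \<bar>x\<bar> > 1 \<longrightarrow> D_sigma D \<sigma> x = 0"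
      using ev eventually_scaled_less[of 1 l, OF zero_less_one] by eventually_elim force
    have "sup_deriv (model_rep D f) K p \<phi> \<in> O[at_right 0](\<lambda>\<epsilon>. 1 / \<epsilon> ^ q)" if \<phi>q: "\<phi> \<in> A_test q" for \<phi>
    proof -
      have \<phi>: "\<phi> \<in> A_test 0" using \<phi>q A_antimono[of 0 q] by auto
      obtain M where M: "\<forall>\<^sub>F \<epsilon> in at_right 0. \<forall>x\<in>{-1..1}.
         norm ((vderiv ^^ p) (delta_rep D (scaled \<epsilon> \<phi>)) x) \<le> M * norm (1 / \<epsilon> ^ q)"
        using q[OF \<phi>q] sup_deriv_bigo_iff[OF E_M_basic[OF D(3)] \<phi> I] by auto
      have "\<forall>\<^sub>F \<epsilon> in at_right 0. \<forall>x\<in>K.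
         norm ((vderiv ^^ p) (model_rep D f (scaled \<epsilon> \<phi>)) x) \<le> (2 * B * M) * norm (1 / \<epsilon> ^ q)"
        using M filterlim_supp_radius_scaled[OF \<phi>, unfolded filterlim_iff, rule_format, OF supp]
          eventually_at_right_less[of 0]
      proof eventually_elim
        case (elim \<epsilon>)
        define \<sigma> where "\<sigma> = supp_radius (scaled \<epsilon> \<phi>)"
        define \<theta> where "\<theta> = (vderiv ^^ p) (D_sigma D \<sigma>)"
        have "\<sigma> > 0" unfolding \<sigma>_def using elim \<phi> by (intro supp_radius_pos scaled_in_A)
        then have D\<sigma>: "D_sigma D \<sigma> \<in> test_funs" by (intro D_sigma_test_funs D)
        have \<theta>: "norm (\<theta> x) \<le> M * norm (1 / \<epsilon> ^ q)" if "\<bar>x\<bar> \<le> 1" for x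
          using elim(1) that by (auto simp: \<theta>_def \<sigma>_def delta_rep_def abs_le_iff)
        have \<theta>0: "\<theta> x = 0" if "\<bar>x\<bar> > 1" for x
          unfolding \<theta>_def using elim(2) that by (intro vderiv_funpow_eq_0_outside[of 1]) (auto simp: \<sigma>_def)
        show ?case
        proof
          fix x assume x: "x \<in> K"
          have "norm (convolution f \<theta> x) \<le> 2 * 1 * (B * (M * norm (1 / \<epsilon> ^ q)))"
            unfolding convolution_def
          proof (rule norm_integral_le[where a = x])
            fix y assume y: "\<bar>y - x\<bar> \<le> 1"
            then show "norm (f y * \<theta> (x - y)) \<le> B * (M * norm (1 / \<epsilon> ^ q))"
              unfolding norm_mult using R[OF x] B(1) by (intro mult_mono B \<theta>) auto
          qed (auto simp: \<theta>0)
          then show "norm ((vderiv ^^ p) (model_rep D f (scaled \<epsilon> \<phi>)) x) \<le> (2 * B * M) * norm (1 / \<epsilon> ^ q)"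
            by (simp add: model_rep_def \<sigma>_def[symmetric] vderiv_funpow_convolution f D\<sigma> \<theta>_def)
        qed
      qed
      then show ?thesis
        by (subst sup_deriv_bigo_iff[OF basic \<phi> K]) blast
    qed
    then show ?thesis by blast
  qed
  with basic show ?thesis by (simp add: E_M_def)
qed

section \<open>The limiting distribution and the proof of association\<close>

lemma vderiv_funpow_le_SUP:
  assumes "\<psi> \<in> test_funs"
  shows "norm ((vderiv ^^ k) \<psi> y) \<le> (SUP x. norm ((vderiv ^^ k) \<psi> x))"
proof (rule cSUP_upper)
  obtain B where "\<And>x. norm ((vderiv ^^ k) \<psi> x) \<le> B"
    using test_funs_bounded[OF test_funs_vderiv_funpow[OF assms]] by metis
  then show "bdd_above (range (\<lambda>x. norm ((vderiv ^^ k) \<psi> x)))" by (intro bdd_aboveI[of _ B]) auto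
qed simp

lemma distribution_dirac_combination:
  "distribution (\<lambda>\<psi>. a * dirac \<psi> - b * dist_deriv dirac \<psi> + c * (dist_deriv ^^ 2) dirac \<psi>)"
proof -
  \<comment> \<open>The first distributional derivative brings a minus sign that cancels the one in
    front of \<open>b\<close>; the second brings two.\<close>
  have eq: "a * dirac \<psi> - b * dist_deriv dirac \<psi> + c * (dist_deriv ^^ 2) dirac \<psi> =
      a * \<psi> 0 + b * (vderiv ^^ 1) \<psi> 0 + c * (vderiv ^^ 2) \<psi> 0" for \<psi>
    by (simp add: dirac_def dist_deriv_def numeral_2_eq_2)
  show ?thesis unfolding distribution_def eq
  proof (intro conjI ballI allI impI)
    fix \<psi> \<xi> assume "\<psi> \<in> test_funs" "\<xi> \<in> test_funs"
    then show "a * (\<psi> 0 + \<xi> 0) + b * (vderiv ^^ 1) (\<lambda>x. \<psi> x + \<xi> x) 0 + c * (vderiv ^^ 2) (\<lambda>x. \<psi> x + \<xi> x) 0 =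
       a * \<psi> 0 + b * (vderiv ^^ 1) \<psi> 0 + c * (vderiv ^^ 2) \<psi> 0 + (a * \<xi> 0 + b * (vderiv ^^ 1) \<xi> 0 + c * (vderiv ^^ 2) \<xi> 0)"
      by (simp only: vderiv_funpow_add test_funs_smooth) (simp add: algebra_simps)
  next
    fix d \<psi> assume \<psi>: "\<psi> \<in> test_funs"
    have cm: "vderiv (\<lambda>x. d * \<theta> x) = (\<lambda>x. d * vderiv \<theta> x)" if "\<theta> \<in> test_funs" for \<theta>
      using that by (intro vderiv_eqI has_vector_derivative_mult_right smooth_has_vderiv test_funs_smooth)
    show "a * (d * \<psi> 0) + b * (vderiv ^^ 1) (\<lambda>x. d * \<psi> x) 0 + c * (vderiv ^^ 2) (\<lambda>x. d * \<psi> x) 0 =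
       d * (a * \<psi> 0 + b * (vderiv ^^ 1) \<psi> 0 + c * (vderiv ^^ 2) \<psi> 0)"
      using \<psi> by (simp add: numeral_2_eq_2 cm test_funs_vderiv algebra_simps)
  next
    fix K :: "real set"
    \<comment> \<open>One constant and the order \<open>N = 2\<close> serve all compact sets
      \<open>K\<close>, since only values at the origin are evaluated.\<close>
    define A where "A = norm a + norm b + norm c"
    have "norm (a * \<psi> 0 + b * (vderiv ^^ 1) \<psi> 0 + c * (vderiv ^^ 2) \<psi> 0)
       \<le> A * (\<Sum>k\<le>2. SUP x. norm ((vderiv ^^ k) \<psi> x))" if \<psi>: "\<psi> \<in> test_funs" for \<psi>
    proof -
      let ?s = "\<lambda>k. SUP x. norm ((vderiv ^^ k) \<psi> x)"
      have nn: "0 \<le> ?s k" for k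
        using vderiv_funpow_le_SUP[OF \<psi>, of k 0] norm_ge_zero order_trans by blast
      have le: "norm (z * (vderiv ^^ k) \<psi> 0) \<le> norm z * sum ?s {..2}" if "k \<le> 2" for z k
      proof -
        have "norm ((vderiv ^^ k) \<psi> 0) \<le> ?s k" by (rule vderiv_funpow_le_SUP[OF \<psi>])
        also have "\<dots> \<le> sum ?s {..2}" using that nn by (intro member_le_sum) auto
        finally show ?thesis by (simp add: norm_mult mult_left_mono)
      qed
      have "norm (a * (vderiv ^^ 0) \<psi> 0 + b * (vderiv ^^ 1) \<psi> 0 + c * (vderiv ^^ 2) \<psi> 0) \<le>
          norm a * sum ?s {..2} + norm b * sum ?s {..2} + norm c * sum ?s {..2}"
        by (intro norm_triangle_mono le) auto
      then show ?thesis by (simp add: A_def algebra_simps)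
    qed
    then show "\<exists>C N. \<forall>\<psi>\<in>test_funs. {x. \<psi> x \<noteq> 0} \<subseteq> K \<longrightarrow>
        norm (a * \<psi> 0 + b * (vderiv ^^ 1) \<psi> 0 + c * (vderiv ^^ 2) \<psi> 0)
        \<le> C * (\<Sum>k\<le>N. SUP x. norm ((vderiv ^^ k) \<psi> x))" by blast
  qed
qed

text \<open>The identity \<open>integral_model_mult_vderiv2\<close> holds for each positive
  \<open>\<sigma>\<close>, and each of its five terms has a limit. The two square terms contribute
  the jumps, the three convolution terms the means.\<close>

lemma model_mult_delta_vderiv2_tendsto:
  assumes f: "f \<in> C_d 3" and D: "delta_modelling D" "uniformly_localized D" and \<psi>: "\<psi> \<in> test_funs"
  shows "((\<lambda>\<sigma>. LINT x|lborel. convolution f (D_sigma D \<sigma>) x * vderiv (vderiv (D_sigma D \<sigma>)) x * \<psi> x) \<longlongrightarrow>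
    (h_coeff f 1 + m_coeff f 2) * \<psi> 0 + (3 / 2 * h_coeff f 0 + 2 * m_coeff f 1) * vderiv \<psi> 0
      + m_coeff f 0 * (vderiv ^^ 2) \<psi> 0) (at_right 0)"
proof -
  have pw: "pw_cont ((vderiv ^^ k) f)" if "k < 3" for k using C_d_pw_cont[OF f that] .
  have m: "((\<lambda>\<sigma>. LINT x|lborel. convolution ((vderiv ^^ k) f) (D_sigma D \<sigma>) x * D_sigma D \<sigma> x * \<xi> x)
     \<longlongrightarrow> m_coeff f k * \<xi> 0) (at_right 0)" if "k < 3" "\<xi> \<in> test_funs" for k \<xi>
    unfolding m_coeff_def by (intro convolution_D_sigma_tendsto D pw that)
  have \<psi>': "vderiv \<psi> \<in> test_funs" "(vderiv ^^ 2) \<psi> \<in> test_funs"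
    using \<psi> test_funs_vderiv test_funs_vderiv_funpow by blast+
  have "((\<lambda>\<sigma>. h_coeff f 1 * (LINT x|lborel. (D_sigma D \<sigma> x)\<^sup>2 * \<psi> x)
    + 3 / 2 * h_coeff f 0 * (LINT x|lborel. (D_sigma D \<sigma> x)\<^sup>2 * vderiv \<psi> x)
    + (LINT x|lborel. convolution ((vderiv ^^ 2) f) (D_sigma D \<sigma>) x * D_sigma D \<sigma> x * \<psi> x)
    + 2 * (LINT x|lborel. convolution (vderiv f) (D_sigma D \<sigma>) x * D_sigma D \<sigma> x * vderiv \<psi> x)
    + (LINT x|lborel. convolution f (D_sigma D \<sigma>) x * D_sigma D \<sigma> x * (vderiv ^^ 2) \<psi> x)) \<longlongrightarrow>
    h_coeff f 1 * \<psi> 0 + 3 / 2 * h_coeff f 0 * vderiv \<psi> 0 + m_coeff f 2 * \<psi> 0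
      + 2 * (m_coeff f 1 * vderiv \<psi> 0) + m_coeff f 0 * (vderiv ^^ 2) \<psi> 0) (at_right 0)"
    using m[of 0] m[of 1] m[of 2]
    by (intro tendsto_add tendsto_mult tendsto_const D_sigma_square_tendsto D \<psi> \<psi>') (auto simp: \<psi> \<psi>')
  moreover have "h_coeff f 1 * \<psi> 0 + 3 / 2 * h_coeff f 0 * vderiv \<psi> 0 + m_coeff f 2 * \<psi> 0
      + 2 * (m_coeff f 1 * vderiv \<psi> 0) + m_coeff f 0 * (vderiv ^^ 2) \<psi> 0 =
    (h_coeff f 1 + m_coeff f 2) * \<psi> 0 + (3 / 2 * h_coeff f 0 + 2 * m_coeff f 1) * vderiv \<psi> 0
      + m_coeff f 0 * (vderiv ^^ 2) \<psi> 0"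
    by (simp add: algebra_simps)
  moreover have "\<forall>\<^sub>F \<sigma> in at_right 0.
    (LINT x|lborel. convolution f (D_sigma D \<sigma>) x * vderiv (vderiv (D_sigma D \<sigma>)) x * \<psi> x) =
    h_coeff f 1 * (LINT x|lborel. (D_sigma D \<sigma> x)\<^sup>2 * \<psi> x)
    + 3 / 2 * h_coeff f 0 * (LINT x|lborel. (D_sigma D \<sigma> x)\<^sup>2 * vderiv \<psi> x)
    + (LINT x|lborel. convolution ((vderiv ^^ 2) f) (D_sigma D \<sigma>) x * D_sigma D \<sigma> x * \<psi> x)
    + 2 * (LINT x|lborel. convolution (vderiv f) (D_sigma D \<sigma>) x * D_sigma D \<sigma> x * vderiv \<psi> x)
    + (LINT x|lborel. convolution f (D_sigma D \<sigma>) x * D_sigma D \<sigma> x * (vderiv ^^ 2) \<psi> x)"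
    using eventually_at_right_less[of 0]
    by eventually_elim (intro integral_model_mult_vderiv2 f \<psi> D_sigma_test_funs D)
  ultimately show ?thesis by (simp only: tendsto_cong)
qed

theorem theorem2:
  fixes f :: "real \<Rightarrow> complex" and D :: "real \<Rightarrow> real \<Rightarrow> complex"
  assumes "f \<in> C_d 3"
    and "delta_modelling D"
    and "uniformly_localized D"
    and "delta_rep D \<in> E_M"
  shows "model_rep D f \<in> E_M \<and>
    colombeau_class (model_rep D f) * (colombeau_deriv ^^ 2) (colombeau_class (delta_rep D)) \<approx>\<^sub>D
      (\<lambda>\<psi>. (h_coeff f 1 + m_coeff f 2) * dirac \<psi>
         - (3 / 2 * h_coeff f 0 + 2 * m_coeff f 1) * dist_deriv dirac \<psi>
         + m_coeff f 0 * (dist_deriv ^^ 2) dirac \<psi>)"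
proof -
  have F: "model_rep D f \<in> E_M"
    using C_d_pw_cont[OF assms(1), of 0] by (intro model_rep_E_M assms) simp
  define G where "G = (\<lambda>\<phi> x. model_rep D f \<phi> x * dx (dx (delta_rep D)) \<phi> x)"
  have D2: "dx (delta_rep D) \<in> E_M" "dx (dx (delta_rep D)) \<in> E_M"
    using assms(4) by (auto intro: E_M_dx)
  have G: "G \<in> E_M" unfolding G_def by (intro E_M_mult F D2)
  \<comment> \<open>The quotient is partial, so computing with classes requires each representative
    to be related to itself, that is, to be moderate.\<close>
  have cls: "colombeau_class G =
      colombeau_class (model_rep D f) * (colombeau_deriv ^^ 2) (colombeau_class (delta_rep D))"
    using F D2 assms(4)
    by (simp add: G_def numeral_2_eq_2 colombeau_deriv.abs_eq times_colombeau.abs_eq colombeau_eq_refl)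
  \<comment> \<open>\<open>G\<close> depends on \<open>\<phi>\<close> only through its support
    radius. The limit thus holds throughout \<open>A_test 0\<close>, and the order 0 serves for
    every \<open>\<psi>\<close>.\<close>
  have "((\<lambda>\<epsilon>. LINT x|lborel. G (scaled \<epsilon> \<phi>) x * \<psi> x) \<longlongrightarrow>
      (h_coeff f 1 + m_coeff f 2) * dirac \<psi>
         - (3 / 2 * h_coeff f 0 + 2 * m_coeff f 1) * dist_deriv dirac \<psi>
         + m_coeff f 0 * (dist_deriv ^^ 2) dirac \<psi>) (at_right 0)"
    if "\<psi> \<in> test_funs" "\<phi> \<in> A_test 0" for \<psi> \<phi>
    using filterlim_compose[OF model_mult_delta_vderiv2_tendsto[OF assms(1-3) that(1)]
        filterlim_supp_radius_scaled[OF that(2)]]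
    by (simp add: G_def model_rep_def delta_rep_def dx_def dirac_def dist_deriv_def numeral_2_eq_2)
  then show ?thesis
    unfolding associated_def
    by (intro conjI F distribution_dirac_combination bexI[OF _ G] cls ballI exI[of _ 0])
qed

end
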